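(* For every composition $\alpha=(\alpha_1,\dots,\alpha_s)$ with $\alpha_1,\alpha_s\ge2$, the map $$\phi:\{\mathcal O\mid \mathcal O\text{ an orbit of rowmotion on antichains of }\breve F(\alpha)\}\to\{T\mid T\text{ an }\alpha\text{-tiling}\}$$ (with $\alpha$-tilings considered up to horizontal translation) is a (well-defined) bijection.
   Context: Fences. Put $p_0=0$, $p_i=\alpha_1+\dots+\alpha_i$ and $n=p_s-1$. The fence $\breve F(\alpha)$ is the poset on $\{x_1,\dots,x_n\}$ with covering relations, for $1\le k<n$ and $i$ such that $p_{i-1}\le k<p_i$: $x_k\lhd x_{k+1}$ if $i$ is odd, and $x_k\rhd x_{k+1}$ if $i$ is even. The $i$th segment $S_i$ is the chain of the $x_k$ with $p_{i-1}\le k\le p_i$, $1\le k\le n$. An element is shared if it lies in two segments (these are the $x_{p_i}$, $1\le i\le s-1$, with $x_{p_i}\in S_i\cap S_{i+1}$), and unshared otherwise; $S_i$ has $\alpha_i-1$ unshared elements. Rowmotion. Rowmotion on antichains is the bijection $\rho$ sending an antichain $A$ to the set of minimal elements of the complement of the (lower order) ideal generated by $A$; orbits are those of the cyclic group generated by $\rho$. Tilings. $H_s$ is the horizontal strip of unit squares with rows $1,\dots,s$ (top to bottom) and columns indexed by $\mathbb Z$ (left to right). An $a\times b$ tile covers $a$ rows and $b$ columns. An $\alpha$-tiling is a tiling of $H_s$ using yellow $1\times1$ tiles, red $2\times1$ tiles, and black $1\times(\alpha_i-1)$ tiles in row $i$, $1\le i\le s$ (so no black tiles in row $i$ if $\alpha_i=1$),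 such that for all rows: (a) if $\alpha_i>1$ and the red tiles are ignored, then the black and yellow tiles alternate in row $i$; (b) there is a red tile in a column covering rows $i$ and $i+1$ if and only if either the previous column contains two yellow tiles in those two rows when $i$ is even, or the next column contains two yellow tiles in those two rows when $i$ is odd. Two tilings are the same if one is a horizontal translate of the other. The map $\phi$. Given an orbit $\mathcal O$, pick $A\in\mathcal O$ and let column $k\in\mathbb Z$ correspond to the antichain $\rho^k(A)$. Color the square in row $i$ of column $k$ yellow, red or black according to whether $S_i\cap\rho^k(A)$ is empty, a shared element, or an unshared element, respectively. Red squares form $2\times 1$ tiles: a shared element of $S_i\cap S_{i+1}$ in $\rho^k(A)$ gives a red tile in column $k$ covering rows $i,i+1$. The black squares in row $i$ are grouped into $1\times(\alpha_i-1)$ tiles so that the $j$th square of a tile corresponds to the $j$th smallest unshared element of $S_i$. The result, up to translation, is $\phi(\mathcal O)$. *)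

theory Defs
  imports Main
begin

section \<open>Fences\<close>

definition is_composition :: "nat list \<Rightarrow> bool" where
  "is_composition \<alpha> \<longleftrightarrow> \<alpha> \<noteq> [] \<and> (\<forall>a\<in>set \<alpha>. 1 \<le> a)"

text \<open>Parts, segments and rows are numbered from \<open>1\<close>, whereas list positions start at \<open>0\<close>.\<close>

definition part :: "nat list \<Rightarrow> nat \<Rightarrow> nat" where
  "part \<alpha> i = \<alpha> ! (i - 1)"

definition psum :: "nat list \<Rightarrow> nat \<Rightarrow> nat" where
  "psum \<alpha> i = (\<Sum>j=1..i. part \<alpha> j)"

definition fence_size :: "nat list \<Rightarrow> nat" where
  "fence_size \<alpha> = psum \<alpha> (length \<alpha>) - 1"

text \<open>The element \<open>x\<^sub>k\<close> of the fence is represented by the number \<open>k\<close>.\<close>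

definition fence :: "nat list \<Rightarrow> nat set" where
  "fence \<alpha> = {1..fence_size \<alpha>}"

text \<open>\<open>(a, b) \<in> fence_cover \<alpha>\<close> means that \<open>b\<close> covers \<open>a\<close>.\<close>

definition fence_cover :: "nat list \<Rightarrow> (nat \<times> nat) set" where
  "fence_cover \<alpha> =
     {(k, k + 1) |k i. 1 \<le> k \<and> k < fence_size \<alpha> \<and> 1 \<le> i \<and> i \<le> length \<alpha> \<and>
        psum \<alpha> (i - 1) \<le> k \<and> k < psum \<alpha> i \<and> odd i} \<union>
     {(k + 1, k) |k i. 1 \<le> k \<and> k < fence_size \<alpha> \<and> 1 \<le> i \<and> i \<le> length \<alpha> \<and>
        psum \<alpha> (i - 1) \<le> k \<and> k < psum \<alpha> i \<and> even i}"

text \<open>\<open>(a, b) \<in> fence_le \<alpha>\<close> means \<open>a \<le> b\<close> in the fence.\<close>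

definition fence_le :: "nat list \<Rightarrow> (nat \<times> nat) set" where
  "fence_le \<alpha> = (fence_cover \<alpha>)\<^sup>* \<inter> fence \<alpha> \<times> fence \<alpha>"

definition segment :: "nat list \<Rightarrow> nat \<Rightarrow> nat set" where
  "segment \<alpha> i = {k \<in> fence \<alpha>. psum \<alpha> (i - 1) \<le> k \<and> k \<le> psum \<alpha> i}"

definition shared :: "nat list \<Rightarrow> nat set" where
  "shared \<alpha> = {x. \<exists>i\<in>{1..length \<alpha>}. \<exists>j\<in>{1..length \<alpha>}. i \<noteq> j \<and> x \<in> segment \<alpha> i \<and> x \<in> segment \<alpha> j}"

definition unshared_in :: "nat list \<Rightarrow> nat \<Rightarrow> nat set" where
  "unshared_in \<alpha> i = segment \<alpha> i - shared \<alpha>"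

text \<open>\<open>x\<close> is the \<open>j\<close>th smallest element (\<open>j \<ge> 1\<close>) of \<open>C\<close> with respect to the fence order, for
  a chain \<open>C\<close>.\<close>

definition is_jth_smallest :: "nat list \<Rightarrow> nat set \<Rightarrow> nat \<Rightarrow> nat \<Rightarrow> bool" where
  "is_jth_smallest \<alpha> C j x \<longleftrightarrow> x \<in> C \<and> card {y \<in> C. (y, x) \<in> fence_le \<alpha>} = j"


section \<open>Rowmotion on antichains\<close>

definition antichains :: "nat list \<Rightarrow> nat set set" where
  "antichains \<alpha> = {A. A \<subseteq> fence \<alpha> \<and> (\<forall>x\<in>A. \<forall>y\<in>A. (x, y) \<in> fence_le \<alpha> \<longrightarrow> x = y)}"

definition gen_ideal :: "nat list \<Rightarrow> nat set \<Rightarrow> nat set" where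
  "gen_ideal \<alpha> A = {x. \<exists>a\<in>A. (x, a) \<in> fence_le \<alpha>}"

definition minimal_elems :: "nat list \<Rightarrow> nat set \<Rightarrow> nat set" where
  "minimal_elems \<alpha> C = {x \<in> C. \<forall>y\<in>C. (y, x) \<in> fence_le \<alpha> \<longrightarrow> y = x}"

definition rowmotion :: "nat list \<Rightarrow> nat set \<Rightarrow> nat set" where
  "rowmotion \<alpha> A = minimal_elems \<alpha> (fence \<alpha> - gen_ideal \<alpha> A)"

text \<open>Integer powers of rowmotion; rowmotion is a bijection only on the antichains, so this is
  where the inverse has to be taken.\<close>

definition rowmotion_pow :: "nat list \<Rightarrow> int \<Rightarrow> nat set \<Rightarrow> nat set" where
  "rowmotion_pow \<alpha> k A =
     (if 0 \<le> k then (rowmotion \<alpha> ^^ nat k) A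
      else (inv_into (antichains \<alpha>) (rowmotion \<alpha>) ^^ nat (- k)) A)"

definition rowmotion_orbits :: "nat list \<Rightarrow> nat set set set" where
  "rowmotion_orbits \<alpha> = {{rowmotion_pow \<alpha> k A |k. True} |A. A \<in> antichains \<alpha>}"


section \<open>Tilings\<close>

text \<open>A coloured tile is given by the row and column of its top left square, the
  shape being determined by the colour and, for black tiles, by the row.\<close>

datatype tile = Yellow nat int | Red nat int | Black nat int

fun squares :: "nat list \<Rightarrow> tile \<Rightarrow> (nat \<times> int) set" where
  "squares \<alpha> (Yellow i k) = {(i, k)}"
| "squares \<alpha> (Red i k) = {(i, k), (i + 1, k)}"
| "squares \<alpha> (Black i k) = {i} \<times> {k ..< k + (int (part \<alpha> i) - 1)}"

definition strip :: "nat list \<Rightarrow> (nat \<times> int) set" where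
  "strip \<alpha> = {1..length \<alpha>} \<times> UNIV"

text \<open>The nonemptiness requirement excludes black tiles in row \<open>i\<close> if \<open>\<alpha>\<^sub>i = 1\<close>.\<close>

definition is_tiling :: "nat list \<Rightarrow> tile set \<Rightarrow> bool" where
  "is_tiling \<alpha> T \<longleftrightarrow>
     (\<forall>t\<in>T. squares \<alpha> t \<noteq> {} \<and> squares \<alpha> t \<subseteq> strip \<alpha>) \<and>
     (\<forall>q\<in>strip \<alpha>. \<exists>!t. t \<in> T \<and> q \<in> squares \<alpha> t)"

definition non_red_at :: "tile set \<Rightarrow> nat \<Rightarrow> int \<Rightarrow> bool" where
  "non_red_at T i k \<longleftrightarrow> Yellow i k \<in> T \<or> Black i k \<in> T"

text \<open>Of any two non-red tiles of row \<open>i\<close> that are consecutive when the red tiles are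
  ignored, one is yellow and the other is black.\<close>

definition alternating_row :: "tile set \<Rightarrow> nat \<Rightarrow> bool" where
  "alternating_row T i \<longleftrightarrow>
     (\<forall>k l. k < l \<and> non_red_at T i k \<and> non_red_at T i l \<and> (\<forall>m. k < m \<and> m < l \<longrightarrow> \<not> non_red_at T i m) \<longrightarrow>
        (Yellow i k \<in> T \<and> Black i l \<in> T) \<or> (Black i k \<in> T \<and> Yellow i l \<in> T))"

definition red_condition :: "tile set \<Rightarrow> nat \<Rightarrow> bool" where
  "red_condition T i \<longleftrightarrow>
     (\<forall>k. Red i k \<in> T \<longleftrightarrow>
        (even i \<and> Yellow i (k - 1) \<in> T \<and> Yellow (i + 1) (k - 1) \<in> T) \<or>
        (odd i \<and> Yellow i (k + 1) \<in> T \<and> Yellow (i + 1) (k + 1) \<in> T))"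

definition alpha_tilings :: "nat list \<Rightarrow> tile set set" where
  "alpha_tilings \<alpha> =
     {T. is_tiling \<alpha> T \<and>
         (\<forall>i. 1 \<le> i \<and> i \<le> length \<alpha> \<and> 1 < part \<alpha> i \<longrightarrow> alternating_row T i) \<and>
         (\<forall>i. 1 \<le> i \<and> i < length \<alpha> \<longrightarrow> red_condition T i)}"

fun shift_tile :: "int \<Rightarrow> tile \<Rightarrow> tile" where
  "shift_tile d (Yellow i k) = Yellow i (k + d)"
| "shift_tile d (Red i k) = Red i (k + d)"
| "shift_tile d (Black i k) = Black i (k + d)"

definition translation_rel :: "nat list \<Rightarrow> (tile set \<times> tile set) set" where
  "translation_rel \<alpha> =
     {(T, T'). T \<in> alpha_tilings \<alpha> \<and> T' \<in> alpha_tilings \<alpha> \<and> (\<exists>d. T' = shift_tile d ` T)}"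


section \<open>The map from orbits to tilings\<close>

text \<open>The tiles drawn from the antichain \<open>A\<close> in column \<open>0\<close>. A black tile starts at column \<open>k\<close>
  of row \<open>i\<close> if the squares in its \<open>\<alpha>\<^sub>i - 1\<close> columns correspond, in this order, to the
  smallest, second smallest, ... unshared element of the \<open>i\<close>th segment.\<close>

definition tiling_of :: "nat list \<Rightarrow> nat set \<Rightarrow> tile set" where
  "tiling_of \<alpha> A =
     {Yellow i k |i k. i \<in> {1..length \<alpha>} \<and> segment \<alpha> i \<inter> rowmotion_pow \<alpha> k A = {}} \<union>
     {Red i k |i k. 1 \<le> i \<and> i < length \<alpha> \<and>
        segment \<alpha> i \<inter> segment \<alpha> (i + 1) \<inter> rowmotion_pow \<alpha> k A \<noteq> {}} \<union>
     {Black i k |i k. i \<in> {1..length \<alpha>} \<and> 1 < part \<alpha> i \<and>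
        (\<forall>j\<in>{1..part \<alpha> i - 1}. \<exists>x. is_jth_smallest \<alpha> (unshared_in \<alpha> i) j x \<and>
           x \<in> rowmotion_pow \<alpha> (k + int j - 1) A)}"

definition phi :: "nat list \<Rightarrow> nat set set \<Rightarrow> tile set set" where
  "phi \<alpha> \<O> = translation_rel \<alpha> `` {tiling_of \<alpha> (SOME A. A \<in> \<O>)}"

end

theory Submission
  imports Defs
begin

text \<open>
  For antichains \<open>A\<close> and \<open>B\<close>, \<open>B\<close> is the rowmotion of \<open>A\<close> iff every element of the fence lies
  either weakly below an element of \<open>A\<close> or weakly above an element of \<open>B\<close>, but not both. At a shared element
  this is the condition on red tiles. At the unshared elements of a segment it says how a row may
  continue from one column to the next, and, once the condition on red tiles is known, such
  continuations are the same as grouping black squares into tiles that alternate with yellow ones.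
  So \<open>\<alpha>\<close>-tilings correspond to bi-infinite sequences \<open>X\<close> of antichains with
  \<open>X (k + 1) = \<rho> (X k)\<close>. As \<open>\<rho>\<close> is injective, such a sequence is determined by \<open>X 0\<close>, and
  translating the tiling moves \<open>X 0\<close> through its orbit.
\<close>

section \<open>A single row\<close>

text \<open>The obstacle is that alternation in a row is not local: red squares may separate
  consecutive non-red tiles, whereas rowmotion relates adjacent columns only. The condition on red
  tiles bounds these gaps. In a fixed row, a red square at the bottom of the segment has a yellow
  square just before it, and a red square at the top has one just after it. Hence in an admissible
  row at most one red square, at the bottom, stands between a yellow tile and the next black one,
  and at most one, at the top, between a black tile and the next yellow one. Whether a shared
  element is a bottom or a top depends on the parity of its index, which is why the red condition
  looks backward in one case and forward in the other. Measuring heights along the order instead of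
  the numbering removes this parity from the argument about a row.\<close>

text \<open>\<open>E j k\<close> says that the antichain in column \<open>k\<close> contains the element at height \<open>j\<close> of a fixed
  segment; heights \<open>0\<close> and \<open>m\<close> are its shared ends. The assumption \<open>slide\<close> comes from the grouping
  of the black squares into tiles, \<open>low\<close> and \<open>high\<close> come from the condition on red tiles.\<close>

locale row =
  fixes m :: nat and E :: "nat \<Rightarrow> int \<Rightarrow> bool"
  assumes m: "2 \<le> m"
    and unique: "E j k \<Longrightarrow> E j' k \<Longrightarrow> j \<le> m \<Longrightarrow> j' \<le> m \<Longrightarrow> j = j'"
    and slide: "1 \<le> j \<Longrightarrow> j + 1 < m \<Longrightarrow> E j k \<longleftrightarrow> E (j + 1) (k + 1)"
    and low: "E 0 k \<Longrightarrow> j \<le> m \<Longrightarrow> \<not> E j (k - 1)"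
    and high: "E m k \<Longrightarrow> j \<le> m \<Longrightarrow> \<not> E j (k + 1)"
begin

definition Y :: "int \<Rightarrow> bool" where
  "Y k \<longleftrightarrow> (\<forall>j\<le>m. \<not> E j k)"

text \<open>A black tile is registered only in the column of its first square, at height
  \<open>1\<close>, just as \<open>Black i k\<close> is. Its later columns count as gaps, like the
  red ones.\<close>

definition N :: "int \<Rightarrow> bool" where
  "N k \<longleftrightarrow> Y k \<or> E 1 k"

definition steps :: bool where
  "steps \<longleftrightarrow> (\<forall>k. \<forall>j\<in>{1..<m}. (\<exists>j'\<in>{j..m}. E j' k) \<noteq> (\<exists>j'\<le>j. E j' (k + 1)))"

definition alternating :: bool where
  "alternating \<longleftrightarrow> (\<forall>k l. k < l \<and> N k \<and> N l \<and> (\<forall>x. k < x \<and> x < l \<longrightarrow> \<not> N x) \<longrightarrow>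
     (Y k \<and> E 1 l) \<or> (E 1 k \<and> Y l))"

lemma slide_run: "1 \<le> j \<Longrightarrow> j + t < m \<Longrightarrow> E j k \<longleftrightarrow> E (j + t) (k + int t)"
proof (induction t)
  case (Suc t)
  then show ?case using slide[of "j + t" "k + int t"] by (simp add: algebra_simps)
qed simp

lemma N_iff: "E j k \<Longrightarrow> j \<le> m \<Longrightarrow> N k \<longleftrightarrow> j = 1"
  using unique[of 1 k j] m by (auto simp: N_def Y_def)

lemma not_N_inner: "1 \<le> j \<Longrightarrow> j < m \<Longrightarrow> E j k \<Longrightarrow> k - int j + 1 < x \<Longrightarrow> x \<le> k \<Longrightarrow> \<not> N x"
proof -
  assume j: "1 \<le> j" "j < m" "E j k" and x: "k - int j + 1 < x" "x \<le> k"
  define t where "t = nat (k - x)"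
  have t: "int t = k - x" "t + 1 < j" using x j by (auto simp: t_def)
  then have "E (j - t) x" using slide_run[of "j - t" t x] j by simp
  then show ?thesis using N_iff[of "j - t" x] t j by simp
qed

text \<open>This is what remains of \<open>steps\<close> once \<open>slide\<close> fixes the
  successor of every black square except the last one of a tile.\<close>

definition local_steps :: bool where
  "local_steps \<longleftrightarrow> (\<forall>k. ((Y k \<or> E 0 k) \<longrightarrow> (E 0 (k + 1) \<or> E 1 (k + 1))) \<and>
     ((E (m - 1) k \<or> E m k) \<longrightarrow> (Y (k + 1) \<or> E m (k + 1))))"

text \<open>A column holds at most one height, so every test in \<open>steps\<close> is a threshold
  on it. The tests at \<open>j = 1\<close> and \<open>j = m - 1\<close> already give
  \<open>local_steps\<close>; conversely, \<open>slide\<close> settles the columns with a non-final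
  black square.\<close>

lemma steps_iff_local: "steps \<longleftrightarrow> local_steps"
proof
  assume st: steps
  show local_steps
    unfolding local_steps_def
  proof (intro allI conjI impI)
    fix k
    assume "Y k \<or> E 0 k"
    then have "\<not> (\<exists>j'\<in>{1..m}. E j' k)" using unique[of 0 k] by (fastforce simp: Y_def)
    then obtain j' where "j' \<le> 1" "E j' (k + 1)"
      using st m unfolding steps_def by (metis Suc_1 Suc_le_lessD atLeastLessThan_iff le_refl)
    then show "E 0 (k + 1) \<or> E 1 (k + 1)" by (cases j') auto
  next
    fix k
    assume "E (m - 1) k \<or> E m k"
    then have "\<exists>j'\<in>{m - 1..m}. E j' k" by (meson atLeastAtMost_iff diff_le_self order_refl)
    moreover have "m - 1 \<in> {1..<m}" using m by auto
    ultimately have "\<not> (\<exists>j'\<le>m - 1. E j' (k + 1))" using st unfolding steps_def by blast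
    then have "\<not> E j (k + 1)" if "j < m" for j using that by simp
    then show "Y (k + 1) \<or> E m (k + 1)" unfolding Y_def using le_neq_implies_less by blast
  qed
next
  assume loc: local_steps
  show steps
    unfolding steps_def
  proof (intro allI ballI)
    fix k j
    assume j: "j \<in> {1..<m}"
    consider "Y k \<or> E 0 k" | c where "1 \<le> c" "c + 1 < m" "E c k" | "E (m - 1) k \<or> E m k"
    proof -
      have "Y k \<or> (\<exists>c\<le>m. E c k)" by (auto simp: Y_def)
      moreover have "c = 0 \<or> (1 \<le> c \<and> c + 1 < m) \<or> c = m - 1 \<or> c = m" if "c \<le> m" for c
        using that by linarith
      ultimately show ?thesis using that by blast
    qed
    then show "(\<exists>j'\<in>{j..m}. E j' k) \<noteq> (\<exists>j'\<le>j. E j' (k + 1))"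
    proof cases
      case 1
      then have "\<not> (\<exists>j'\<in>{j..m}. E j' k)" using unique[of 0 k] j by (fastforce simp: Y_def)
      moreover have "E 0 (k + 1) \<or> E 1 (k + 1)" using loc 1 by (auto simp: local_steps_def)
      then have "\<exists>j'\<le>j. E j' (k + 1)" using j by auto
      ultimately show ?thesis by blast
    next
      case 2
      then have "E (c + 1) (k + 1)" using slide by blast
      then have "(\<exists>j'\<le>j. E j' (k + 1)) \<longleftrightarrow> c + 1 \<le> j"
        using unique[of "c + 1" "k + 1"] j 2 by (metis atLeastLessThan_iff le_trans less_imp_le)
      moreover have "(\<exists>j'\<in>{j..m}. E j' k) \<longleftrightarrow> j \<le> c"
        using unique[of c k] 2 by (metis add_leD1 atLeastAtMost_iff less_imp_le)
      ultimately show ?thesis by auto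
    next
      case 3
      then have "\<exists>j'\<in>{j..m}. E j' k" using j by (elim disjE; intro bexI) auto
      moreover have "Y (k + 1) \<or> E m (k + 1)" using loc 3 by (auto simp: local_steps_def)
      then have "\<not> (\<exists>j'\<le>j. E j' (k + 1))" using j unique[of m "k + 1"] by (fastforce simp: Y_def)
      ultimately show ?thesis by blast
    qed
  qed
qed

text \<open>After a yellow square comes the start of a black tile, possibly delayed by a red square
  at height \<open>0\<close>, which \<open>low\<close> forbids to repeat. After a black tile comes a
  yellow square, possibly delayed by a red square at height \<open>m\<close>, which
  \<open>high\<close> forces to be followed by yellow.\<close>

lemma local_imp_alternating:
  assumes local_steps
  shows alternating
  unfolding alternating_def
proof (intro allI impI)
  fix k l
  assume "k < l \<and> N k \<and> N l \<and> (\<forall>x. k < x \<and> x < l \<longrightarrow> \<not> N x)"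
  then have kl: "k < l" "N k" "N l" and between: "\<And>x. k < x \<Longrightarrow> N x \<Longrightarrow> l \<le> x" by force+
  have first: "E 0 (x + 1) \<or> E 1 (x + 1)" if "Y x \<or> E 0 x" for x
    using assms that unfolding local_steps_def by blast
  show "(Y k \<and> E 1 l) \<or> (E 1 k \<and> Y l)"
  proof (cases "Y k")
    case True
    have "E 1 l"
    proof (cases "E 1 (k + 1)")
      case True
      then have "l = k + 1" using between[of "k + 1"] kl by (simp add: N_def)
      then show ?thesis using True by simp
    next
      case False
      then have 0: "E 0 (k + 1)" using first \<open>Y k\<close> by blast
      then have "l \<noteq> k + 1" using N_iff[of 0 l] kl by auto
      moreover have "E 1 (k + 2)"
        using first[of "k + 1"] 0 low[of "k + 2" 0] by (auto simp: algebra_simps)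
      then have "N (k + 2)" by (simp add: N_def)
      ultimately have "l = k + 2" using between[of "k + 2"] kl by simp
      then show ?thesis using \<open>E 1 (k + 2)\<close> by simp
    qed
    then show ?thesis using True by blast
  next
    case False
    then have E1: "E 1 k" using kl by (simp add: N_def)
    \<comment> \<open>The last column of the black tile that starts in column \<open>k\<close>: it
      has \<open>m - 1\<close> squares.\<close>
    define e where "e = k + int (m - 2)"
    have m1: "1 + (m - 2) = m - 1" "1 + (m - 2) < m" using m by simp_all
    have Ee: "E (m - 1) e" using slide_run[of 1 "m - 2" k] E1 unfolding m1(1) e_def using m1(2) by simp
    have "\<not> N x" if "k < x" "x \<le> e" for x
      using not_N_inner[of "m - 1" e x] Ee that m by (simp add: e_def)
    then have le: "e < l" using kl by force
    have "Y l"
    proof (cases "Y (e + 1)")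
      case True
      then have "l = e + 1" using between[of "e + 1"] le m by (simp add: N_def e_def)
      then show ?thesis using True by simp
    next
      case False
      then have em: "E m (e + 1)" using assms Ee unfolding local_steps_def by blast
      then have "l \<noteq> e + 1" using N_iff[of m l] kl m by auto
      moreover have "Y (e + 2)" using high[OF em] by (simp add: Y_def add.commute)
      then have "N (e + 2)" by (simp add: N_def)
      ultimately have "l = e + 2" using between[of "e + 2"] le m by (simp add: e_def)
      then show ?thesis using \<open>Y (e + 2)\<close> by simp
    qed
    then show ?thesis using E1 by blast
  qed
qed

text \<open>A violated local step would let two yellow tiles, or two black ones, follow each other
  with at most red squares between them. A jump into the interior of a black tile is impossible,
  since \<open>slide\<close> can be read backwards.\<close>

lemma alternating_imp_local:
  assumes alternating
  shows local_steps
proof -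
  have YY: False if "k < l" "Y k" "Y l" "\<And>x. k < x \<Longrightarrow> x < l \<Longrightarrow> \<not> N x" for k l
  proof -
    have "(Y k \<and> E 1 l) \<or> (E 1 k \<and> Y l)"
      using assms that unfolding alternating_def N_def by blast
    then show False using that m by (auto simp: Y_def)
  qed
  have inner: "E (j - 1) k" if "1 < j" "j < m" "E j (k + 1)" for j k
    using slide[of "j - 1" k] that by simp
  have state: "Y x \<or> E 0 x \<or> E 1 x \<or> (\<exists>j. 1 < j \<and> j < m \<and> E j x) \<or> E m x" for x
  proof -
    have "Y x \<or> (\<exists>c\<le>m. E c x)" by (auto simp: Y_def)
    moreover have "c = 0 \<or> c = 1 \<or> (1 < c \<and> c < m) \<or> c = m" if "c \<le> m" for c
      using that by linarith
    ultimately show ?thesis by blast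
  qed
  have mid: "\<not> (1 < j \<and> j < m \<and> E j (k + 1))" if "Y k \<or> E 0 k \<or> E (m - 1) k" for j k
  proof
    assume j: "1 < j \<and> j < m \<and> E j (k + 1)"
    then have e: "E (j - 1) k" using inner by blast
    have "1 < j" "j < m" using j by simp_all
    then have "j - 1 \<le> m" "j - 1 \<noteq> 0" "j - 1 \<noteq> m - 1" by linarith+
    then have "\<not> Y k" "\<not> E 0 k" "\<not> E (m - 1) k"
      using e unique[OF e, of 0] unique[OF e, of "m - 1"] by (auto simp: Y_def)
    then show False using that by blast
  qed
  have first: "E 0 (k + 1) \<or> E 1 (k + 1)"
    if k: "Y k \<or> E 0 k" for k
  proof (rule ccontr)
    assume no: "\<not> ?thesis"
    \<comment> \<open>The column of the last yellow square up to \<open>k\<close>: if column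
      \<open>k\<close> is red at height \<open>0\<close>, then \<open>low\<close> makes column
      \<open>k - 1\<close> yellow.\<close>
    define b where "b = (if Y k then k else k - 1)"
    have b: "Y b" "b \<le> k" and b': "\<And>x. b < x \<Longrightarrow> x \<le> k \<Longrightarrow> \<not> N x"
    proof -
      show "b \<le> k" by (simp add: b_def)
      show "Y b" using k low[of k] by (auto simp: b_def Y_def)
      show "\<not> N x" if "b < x" "x \<le> k" for x
      proof -
        have "x = k" "E 0 k" using that k by (auto simp: b_def split: if_splits)
        then show ?thesis using N_iff[of 0 k] by simp
      qed
    qed
    have "Y (k + 1) \<or> E m (k + 1)" using state[of "k + 1"] no mid k by blast
    then show False
    proof
      assume y: "Y (k + 1)"
      show False by (rule YY[OF _ b(1) y]) (use b b' in auto)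
    next
      assume em: "E m (k + 1)"
      \<comment> \<open>A red square at height \<open>m\<close> only postpones the second yellow
        square by one column.\<close>
      have y: "Y (k + 2)" using high[OF em] by (simp add: Y_def add.commute)
      have "\<not> N (k + 1)" using N_iff[OF em] m by simp
      then have "\<not> N x" if "b < x" "x < k + 2" for x
        using b'[of x] that by (cases "x = k + 1") auto
      then show False using YY[OF _ b(1) y] b by force
    qed
  qed
  have last: "Y (k + 1) \<or> E m (k + 1)" if k: "E (m - 1) k" for k
  proof -
    have "\<not> E 0 (k + 1)" using low[of "k + 1" "m - 1"] k by auto
    moreover have "\<not> E 1 (k + 1)"
    proof
      assume e: "E 1 (k + 1)"
      \<comment> \<open>The first column of the black tile whose last square lies in column
        \<open>k\<close>.\<close>
      define b where "b = k - int (m - 2)"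
      have m1: "1 + (m - 2) = m - 1" "m - 1 < m" using m by simp_all
      have b: "E 1 b" "b \<le> k"
        using slide_run[of 1 "m - 2" b] k unfolding m1(1) b_def using m1(2) by simp_all
      have "\<not> N x" if "b < x" "x < k + 1" for x
        using not_N_inner[of "m - 1" k x] k that m by (simp add: b_def)
      moreover have "N b" "N (k + 1)" "b < k + 1" using b e by (auto simp: N_def)
      ultimately have "(Y b \<and> E 1 (k + 1)) \<or> (E 1 b \<and> Y (k + 1))"
        using assms unfolding alternating_def by blast
      then show False using b e m by (auto simp: Y_def)
    qed
    ultimately show ?thesis using state[of "k + 1"] mid k by blast
  qed
  have "Y (k + 1)" if "E m k" for k using high[OF that] by (simp add: Y_def)
  then show ?thesis unfolding local_steps_def using first last by blast
qed

lemma steps_iff_alternating: "steps \<longleftrightarrow> alternating"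
  using steps_iff_local local_imp_alternating alternating_imp_local by blast

end

locale composition =
  fixes \<alpha> :: "nat list"
  assumes comp: "is_composition \<alpha>"
begin

abbreviation "s \<equiv> length \<alpha>"
abbreviation "a \<equiv> part \<alpha>"
abbreviation "p \<equiv> psum \<alpha>"

section \<open>The order of a fence\<close>

lemma psum_0 [simp]: "p 0 = 0"
  by (simp add: psum_def)

lemma psum_Suc: "p (Suc i) = p i + a (Suc i)"
  by (simp add: psum_def)

lemma psum_pred: "1 \<le> i \<Longrightarrow> p i = p (i - 1) + a i"
  by (cases i) (simp_all add: psum_Suc)

lemma part_pos: "1 \<le> i \<Longrightarrow> i \<le> s \<Longrightarrow> 1 \<le> a i"
  using comp by (auto simp: is_composition_def part_def)

lemma psum_mono: "i \<le> j \<Longrightarrow> p i \<le> p j"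
  by (induction rule: dec_induct) (simp_all add: psum_Suc)

lemma psum_less: "i < j \<Longrightarrow> j \<le> s \<Longrightarrow> p i < p j"
proof -
  assume "i < j" "j \<le> s"
  then have "i \<le> j - 1" "1 \<le> j" by simp_all
  then show ?thesis using psum_mono[of i "j - 1"] psum_pred[of j] part_pos[of j] \<open>j \<le> s\<close> by linarith
qed

lemma psum_in_fence: "1 \<le> l \<Longrightarrow> l < s \<Longrightarrow> p l \<in> fence \<alpha>"
  using psum_less[of 0 l] psum_less[of l s] by (simp add: fence_def fence_size_def)

lemma psum_ends_notin_fence: "p 0 \<notin> fence \<alpha>" "p s \<notin> fence \<alpha>"
  by (auto simp: fence_def fence_size_def)

lemma inner_segment_unique:
  assumes "1 \<le> i" "p (i - 1) < x" "x < p i"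
    and "1 \<le> i'" "p (i' - 1) \<le> x" "x \<le> p i'"
  shows "i' = i"
proof (rule ccontr)
  assume "i' \<noteq> i"
  then consider "i' \<le> i - 1" | "i \<le> i' - 1" using assms by linarith
  then show False
    using psum_mono[of i' "i - 1"] psum_mono[of i "i' - 1"] assms by cases simp_all
qed

lemma psum_segment:
  assumes "1 \<le> l" "l < s" "1 \<le> i" "i \<le> s" "p (i - 1) \<le> p l" "p l \<le> p i"
  shows "i = l \<or> i = l + 1"
proof (rule ccontr)
  assume "\<not> ?thesis"
  then consider "i < l" | "l < i - 1" using assms by linarith
  then show False
    using psum_less[of i l] psum_less[of l "i - 1"] assms by cases linarith+
qed

text \<open>The element at height \<open>j\<close> of the \<open>i\<close>th segment: heights \<open>0\<close> and \<open>a i\<close> are the shared ends,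
  which for the outer segments may be the numbers \<open>p 0\<close> and \<open>p s\<close> outside the fence.\<close>

definition elem :: "nat \<Rightarrow> nat \<Rightarrow> nat" where
  "elem i j = (if odd i then p (i - 1) + j else p i - j)"

lemma elem_le_iff:
  assumes "1 \<le> i" "j \<le> a i" "j' \<le> a i"
  shows "elem i j \<le> elem i j' \<longleftrightarrow> (if odd i then j \<le> j' else j' \<le> j)"
  using assms psum_pred[of i] by (auto simp: elem_def)

lemma elem_inj: "1 \<le> i \<Longrightarrow> j \<le> a i \<Longrightarrow> j' \<le> a i \<Longrightarrow> elem i j = elem i j' \<longleftrightarrow> j = j'"
  using psum_pred[of i] by (auto simp: elem_def)

lemma elem_bounds: "1 \<le> i \<Longrightarrow> j \<le> a i \<Longrightarrow> p (i - 1) \<le> elem i j \<and> elem i j \<le> p i"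
  using psum_pred[of i] by (auto simp: elem_def)

lemma elem_bounds_strict:
  "1 \<le> i \<Longrightarrow> 1 \<le> j \<Longrightarrow> j < a i \<Longrightarrow> p (i - 1) < elem i j \<and> elem i j < p i"
  using psum_pred[of i] by (auto simp: elem_def)

lemma elem_surj:
  assumes "1 \<le> i" "p (i - 1) \<le> x" "x \<le> p i"
  obtains j where "j \<le> a i" "x = elem i j"
proof (rule that)
  show "(if odd i then x - p (i - 1) else p i - x) \<le> a i"
    using assms psum_pred[of i] by auto
  show "x = elem i (if odd i then x - p (i - 1) else p i - x)"
    using assms psum_pred[of i] by (auto simp: elem_def)
qed

lemma segment_iff:
  "1 \<le> i \<Longrightarrow> x \<in> segment \<alpha> i \<longleftrightarrow> x \<in> fence \<alpha> \<and> (\<exists>j\<le>a i. x = elem i j)"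
  unfolding segment_def by (auto simp: elem_bounds[simplified] elim: elem_surj[of i x, simplified])

lemma elem_in_fence:
  assumes "1 \<le> i" "i \<le> s" "1 \<le> j" "j < a i"
  shows "elem i j \<in> fence \<alpha>"
proof -
  have "1 \<le> elem i j" "elem i j \<le> p s - 1"
    using elem_bounds_strict[OF assms(1,3,4)] psum_mono[OF assms(2)] by linarith+
  then show ?thesis by (simp add: fence_def fence_size_def)
qed

lemma elem_eq_inner:
  assumes "1 \<le> i" "1 \<le> j" "j < a i" "1 \<le> i'" "j' \<le> a i'" "elem i j = elem i' j'"
  shows "i' = i \<and> j' = j"
proof -
  have "i' = i"
    using inner_segment_unique[of i "elem i j" i'] elem_bounds_strict[of i j] elem_bounds[of i' j'] assms
    by simp
  then show ?thesis using assms elem_inj[of i j j'] by simp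
qed

text \<open>Odd segments rise with the numbering and even ones fall, so for even \<open>l\<close>
  the element \<open>p l\<close> is the common bottom of its two segments, and for odd
  \<open>l\<close> their common top.\<close>

lemma elem_end:
  assumes "1 \<le> l" "i = l \<or> i = l + 1"
  shows "elem i (if even l then 0 else a i) = p l"
  using assms psum_pred[of l] psum_pred[of "l + 1"] by (auto simp: elem_def)

lemma elem_eq_psum:
  assumes "1 \<le> l" "l < s" "1 \<le> i" "i \<le> s" "j \<le> a i"
  shows "elem i j = p l \<longleftrightarrow> (i = l \<or> i = l + 1) \<and> j = (if even l then 0 else a i)"
proof
  assume e: "elem i j = p l"
  have i: "i = l \<or> i = l + 1"
    using psum_segment[of l i] elem_bounds[of i j] assms e by simp
  then show "(i = l \<or> i = l + 1) \<and> j = (if even l then 0 else a i)"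
    using elem_end[OF assms(1) i] elem_inj[of i j "if even l then 0 else a i"] assms e by auto
next
  assume "(i = l \<or> i = l + 1) \<and> j = (if even l then 0 else a i)"
  then show "elem i j = p l" using elem_end assms by auto
qed

lemma elem_fence_cases:
  assumes "1 \<le> i" "i \<le> s" "j \<le> a i" "elem i j \<in> fence \<alpha>"
  obtains "1 \<le> j" "j < a i"
  | l where "1 \<le> l" "l < s" "i = l \<or> i = l + 1" "j = (if even l then 0 else a i)" "elem i j = p l"
proof (cases "1 \<le> j \<and> j < a i")
  case True
  then show ?thesis using that(1) by blast
next
  case False
  then have j: "j = 0 \<or> j = a i" using assms by linarith
  then have "elem i j = p (i - 1) \<or> elem i j = p i"
    using psum_pred[OF assms(1)] by (auto simp: elem_def)
  then obtain l where l: "elem i j = p l" "l \<in> {i - 1, i}" by blast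
  have "l \<noteq> 0" "l \<noteq> s" using l assms(4) psum_ends_notin_fence by (metis, metis)
  then have l': "1 \<le> l" "l < s" using l(2) assms by auto
  then show ?thesis using that(2)[OF l'] elem_eq_psum[OF l' assms(1-3)] l(1) by blast
qed

lemma fence_cases:
  assumes "x \<in> fence \<alpha>"
  obtains i j where "1 \<le> i" "i \<le> s" "1 \<le> j" "j < a i" "x = elem i j"
  | l where "1 \<le> l" "l < s" "x = p l"
proof -
  \<comment> \<open>Minimality of \<open>i\<close> gives
    \<open>p (i - 1) < x \<le> p i\<close>.\<close>
  define i where "i = (LEAST i. x \<le> p i)"
  have xs: "x \<le> p s" and x0: "1 \<le> x" using assms by (auto simp: fence_def fence_size_def)
  have i: "x \<le> p i" unfolding i_def using xs by (rule LeastI)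
  have i_s: "i \<le> s" unfolding i_def using xs by (rule Least_le)
  have i1: "1 \<le> i" using i x0 by (cases i) auto
  have "\<not> x \<le> p (i - 1)"
    using not_less_Least[of "i - 1" "\<lambda>i. x \<le> p i"] i1 by (simp add: i_def)
  then have lo: "p (i - 1) \<le> x" by simp
  obtain j where j: "j \<le> a i" "x = elem i j" using elem_surj[OF i1 lo i] by blast
  show ?thesis
    using assms j that i1 i_s by (metis elem_fence_cases)
qed

section \<open>Comparability within a segment\<close>

text \<open>A closure-free candidate for the fence order, stated in terms of the numbering; it is
  identified with \<open>fence_le\<close> below.\<close>

definition seg_le :: "nat \<Rightarrow> nat \<Rightarrow> bool" where
  "seg_le x y \<longleftrightarrow> (\<exists>i\<in>{1..s}. x \<in> segment \<alpha> i \<and> y \<in> segment \<alpha> i \<and> (if odd i then x \<le> y else y \<le> x))"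

lemma fence_cover_seg_le:
  assumes "(x, y) \<in> fence_cover \<alpha>"
  shows "seg_le x y"
proof -
  have "segment \<alpha> i = {max 1 (p (i - 1))..min (fence_size \<alpha>) (p i)}" for i
    by (auto simp: segment_def fence_def)
  then have seg: "k \<in> segment \<alpha> i \<and> k + 1 \<in> segment \<alpha> i"
    if "1 \<le> k" "k < fence_size \<alpha>" "p (i - 1) \<le> k" "k < p i" for k i
    using that by simp
  consider (up) k i where "x = k" "y = k + 1" "1 \<le> k" "k < fence_size \<alpha>" "1 \<le> i" "i \<le> s"
      "p (i - 1) \<le> k" "k < p i" "odd i"
    | (down) k i where "x = k + 1" "y = k" "1 \<le> k" "k < fence_size \<alpha>" "1 \<le> i" "i \<le> s"
      "p (i - 1) \<le> k" "k < p i" "even i"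
    using assms unfolding fence_cover_def by blast
  then show ?thesis
  proof cases
    case up
    then show ?thesis unfolding seg_le_def using seg[of k i] by (intro bexI[of _ i]) auto
  next
    case down
    then show ?thesis unfolding seg_le_def using seg[of k i] by (intro bexI[of _ i]) auto
  qed
qed

lemma segment_eq_or_end:
  assumes "i \<in> {1..s}" "i' \<in> {1..s}" "x \<in> segment \<alpha> i" "x \<in> segment \<alpha> i'" "i \<noteq> i'"
  shows "(i' = i + 1 \<and> x = p i) \<or> (i = i' + 1 \<and> x = p i')"
proof -
  have b: "p (i - 1) \<le> x" "x \<le> p i" "p (i' - 1) \<le> x" "x \<le> p i'" and x: "x \<in> fence \<alpha>"
    using assms by (auto simp: segment_def)
  from x show ?thesis
  proof (cases rule: fence_cases)
    case (1 l j)
    then show ?thesis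
      using inner_segment_unique[of l x i] inner_segment_unique[of l x i'] elem_bounds_strict[of l j] assms b
      by auto
  next
    case (2 l)
    then show ?thesis using psum_segment[of l i] psum_segment[of l i'] assms b by auto
  qed
qed

text \<open>Two distinct segments meet at most in a shared element, which is the top of both or the
  bottom of both. A comparison that changes segment there therefore has an equality on one
  side.\<close>

lemma seg_le_trans:
  assumes "seg_le x y" "seg_le y z"
  shows "seg_le x z"
proof -
  obtain i where i: "i \<in> {1..s}" "x \<in> segment \<alpha> i" "y \<in> segment \<alpha> i" "if odd i then x \<le> y else y \<le> x"
    using assms(1) by (auto simp: seg_le_def)
  obtain i' where i': "i' \<in> {1..s}" "y \<in> segment \<alpha> i'" "z \<in> segment \<alpha> i'" "if odd i' then y \<le> z else z \<le> y"
    using assms(2) by (auto simp: seg_le_def)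
  show ?thesis
  proof (cases "i = i'")
    case True
    then have "if odd i then x \<le> z else z \<le> x" using i(4) i'(4) by (auto split: if_splits)
    then show ?thesis using i i' True unfolding seg_le_def by blast
  next
    case False
    have b: "p (i - 1) \<le> x" "x \<le> p i" "p (i' - 1) \<le> z" "z \<le> p i'"
      using i i' by (auto simp: segment_def)
    have "x = y \<or> y = z"
      using segment_eq_or_end[OF i(1) i'(1) i(3) i'(2) False] b i(4) i'(4)
      by (auto split: if_splits)
    then show ?thesis using assms by auto
  qed
qed

text \<open>Covers satisfy \<open>seg_le\<close>, and transitivity extends this to chains of covers.
  Conversely, a segment is an interval of numbers and can be traversed in unit steps, each of which
  is a cover.\<close>

lemma fence_le_seg_le: "(x, y) \<in> fence_le \<alpha> \<longleftrightarrow> seg_le x y"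
proof
  assume "(x, y) \<in> fence_le \<alpha>"
  then have r: "(x, y) \<in> (fence_cover \<alpha>)\<^sup>*" and x: "x \<in> fence \<alpha>" by (auto simp: fence_le_def)
  from r show "seg_le x y"
  proof (induction rule: rtrancl_induct)
    case base
    from x obtain i where "i \<in> {1..s}" "x \<in> segment \<alpha> i"
    proof (cases rule: fence_cases)
      case (1 i j)
      then show ?thesis using that[of i] x elem_bounds[of i j] by (auto simp: segment_def)
    next
      case (2 l)
      then show ?thesis using that[of l] x psum_mono[of "l - 1" l] by (auto simp: segment_def)
    qed
    then show ?case unfolding seg_le_def by auto
  next
    case (step y z)
    then show ?case using fence_cover_seg_le seg_le_trans by blast
  qed
next
  assume "seg_le x y"
  then obtain i where i: "i \<in> {1..s}" "x \<in> segment \<alpha> i" "y \<in> segment \<alpha> i" "if odd i then x \<le> y else y \<le> x"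
    by (auto simp: seg_le_def)
  have conv: "segment \<alpha> i = {max 1 (p (i - 1))..min (fence_size \<alpha>) (p i)}"
    by (auto simp: segment_def fence_def)
  have up: "odd i \<Longrightarrow> (u, v) \<in> (fence_cover \<alpha>)\<^sup>*"
    and down: "even i \<Longrightarrow> (v, u) \<in> (fence_cover \<alpha>)\<^sup>*"
    if "u \<le> v" "u \<in> segment \<alpha> i" "v \<in> segment \<alpha> i" for u v
  proof -
    have *: "(odd i \<longrightarrow> (u, v) \<in> (fence_cover \<alpha>)\<^sup>*) \<and> (even i \<longrightarrow> (v, u) \<in> (fence_cover \<alpha>)\<^sup>*)"
      using that
    proof (induction rule: dec_induct)
      case (step w)
      then have w: "w \<in> segment \<alpha> i" "Suc w \<in> segment \<alpha> i" by (auto simp: conv)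
      then have "1 \<le> w \<and> w < fence_size \<alpha> \<and> 1 \<le> i \<and> i \<le> s \<and> p (i - 1) \<le> w \<and> w < p i"
        using i(1) by (auto simp: conv)
      then have "odd i \<Longrightarrow> (w, Suc w) \<in> fence_cover \<alpha>" "even i \<Longrightarrow> (Suc w, w) \<in> fence_cover \<alpha>"
        unfolding fence_cover_def by auto
      then show ?case
        using step w rtrancl_into_rtrancl[of u w _ "Suc w"] converse_rtrancl_into_rtrancl[of "Suc w" w _ u] by blast
    qed simp
    show "odd i \<Longrightarrow> (u, v) \<in> (fence_cover \<alpha>)\<^sup>*" "even i \<Longrightarrow> (v, u) \<in> (fence_cover \<alpha>)\<^sup>*"
      using * by auto
  qed
  show "(x, y) \<in> fence_le \<alpha>"
    using i up[of x y] down[of y x] by (auto simp: fence_le_def segment_def split: if_splits)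
qed

text \<open>Heights absorb the direction of the segment, so that comparisons no longer split by
  parity.\<close>

lemma fence_le_iff:
  "(x, y) \<in> fence_le \<alpha> \<longleftrightarrow> x \<in> fence \<alpha> \<and> y \<in> fence \<alpha> \<and>
     (\<exists>i\<in>{1..s}. \<exists>j' \<le> a i. \<exists>j\<le>j'. x = elem i j \<and> y = elem i j')"
proof -
  have "(x \<in> segment \<alpha> i \<and> y \<in> segment \<alpha> i \<and> (if odd i then x \<le> y else y \<le> x)) \<longleftrightarrow>
      x \<in> fence \<alpha> \<and> y \<in> fence \<alpha> \<and> (\<exists>j' \<le> a i. \<exists>j\<le>j'. x = elem i j \<and> y = elem i j')"
    (is "?L \<longleftrightarrow> ?R") if "i \<in> {1..s}" for i
  proof -
    have i: "1 \<le> i" using that by simp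
    note le = elem_le_iff[OF i]
    show ?thesis
    proof
      assume L: ?L
      then obtain j j' where j: "j \<le> a i" "x = elem i j" "j' \<le> a i" "y = elem i j'"
        using segment_iff[OF i] by blast
      then have "j \<le> j'" using L le[of j j'] le[of j' j] by (auto split: if_splits)
      then show ?R using L j segment_iff[OF i] by blast
    next
      assume R: ?R
      then obtain j j' where j: "j \<le> j'" "j' \<le> a i" "x = elem i j" "y = elem i j'" by blast
      then have "j \<le> a i" by simp
      then have "x \<in> segment \<alpha> i" "y \<in> segment \<alpha> i" using R j segment_iff[OF i] by blast+
      then show ?L using j \<open>j \<le> a i\<close> le[of j j'] le[of j' j] by simp
    qed
  qed
  then show ?thesis unfolding fence_le_seg_le seg_le_def by blast
qed

section \<open>Rowmotion\<close>

lemma fence_le_refl: "x \<in> fence \<alpha> \<Longrightarrow> (x, x) \<in> fence_le \<alpha>"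
  by (simp add: fence_le_def)

lemma fence_le_trans: "(x, y) \<in> fence_le \<alpha> \<Longrightarrow> (y, z) \<in> fence_le \<alpha> \<Longrightarrow> (x, z) \<in> fence_le \<alpha>"
  by (auto simp: fence_le_def)

lemma fence_le_fence: "(x, y) \<in> fence_le \<alpha> \<Longrightarrow> x \<in> fence \<alpha> \<and> y \<in> fence \<alpha>"
  by (simp add: fence_le_def)

lemma fence_le_antisym:
  assumes "(x, y) \<in> fence_le \<alpha>" "(y, x) \<in> fence_le \<alpha>"
  shows "x = y"
proof -
  obtain i where i: "i \<in> {1..s}" "x \<in> segment \<alpha> i" "y \<in> segment \<alpha> i" "if odd i then x \<le> y else y \<le> x"
    using assms(1) by (auto simp: fence_le_seg_le seg_le_def)
  obtain i' where i': "i' \<in> {1..s}" "x \<in> segment \<alpha> i'" "y \<in> segment \<alpha> i'" "if odd i' then y \<le> x else x \<le> y"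
    using assms(2) by (auto simp: fence_le_seg_le seg_le_def)
  show ?thesis
  proof (cases "i = i'")
    case True
    then show ?thesis using i(4) i'(4) by (simp split: if_splits)
  next
    case False
    then show ?thesis
      using segment_eq_or_end[OF i(1) i'(1) i(2) i'(2)] segment_eq_or_end[OF i(1) i'(1) i(3) i'(3)] by auto
  qed
qed

lemma finite_fence: "finite (fence \<alpha>)"
  by (simp add: fence_def)

text \<open>Descending from \<open>x\<close> inside \<open>C\<close> strictly decreases the number
  of elements of \<open>C\<close> below, so the descent ends.\<close>

lemma minimal_below:
  assumes "C \<subseteq> fence \<alpha>" "x \<in> C"
  shows "\<exists>b\<in>minimal_elems \<alpha> C. (b, x) \<in> fence_le \<alpha>"
  using assms(2)
proof (induction "card {y \<in> C. (y, x) \<in> fence_le \<alpha>}" arbitrary: x rule: less_induct)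
  case less
  show ?case
  proof (cases "x \<in> minimal_elems \<alpha> C")
    case True
    then show ?thesis using less.prems assms(1) fence_le_refl by blast
  next
    case False
    then obtain y where y: "y \<in> C" "(y, x) \<in> fence_le \<alpha>" "y \<noteq> x"
      using less.prems by (auto simp: minimal_elems_def)
    have "{z \<in> C. (z, y) \<in> fence_le \<alpha>} \<subset> {z \<in> C. (z, x) \<in> fence_le \<alpha>}"
    proof
      show "{z \<in> C. (z, y) \<in> fence_le \<alpha>} \<subseteq> {z \<in> C. (z, x) \<in> fence_le \<alpha>}"
        using y(2) fence_le_trans by blast
      have "x \<in> {z \<in> C. (z, x) \<in> fence_le \<alpha>}" "x \<notin> {z \<in> C. (z, y) \<in> fence_le \<alpha>}"
        using less.prems assms(1) fence_le_refl fence_le_antisym y by blast+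
      then show "{z \<in> C. (z, y) \<in> fence_le \<alpha>} \<noteq> {z \<in> C. (z, x) \<in> fence_le \<alpha>}" by blast
    qed
    moreover have "finite {z \<in> C. (z, x) \<in> fence_le \<alpha>}"
      using assms(1) finite_fence by (auto intro: finite_subset)
    ultimately have "card {z \<in> C. (z, y) \<in> fence_le \<alpha>} < card {z \<in> C. (z, x) \<in> fence_le \<alpha>}"
      by (rule psubset_card_mono[rotated])
    from less.hyps[OF this y(1)] show ?thesis using y(2) fence_le_trans by blast
  qed
qed

lemma rowmotion_in_antichains: "rowmotion \<alpha> A \<in> antichains \<alpha>"
  by (auto simp: rowmotion_def antichains_def minimal_elems_def)

lemma antichainsD:
  "A \<in> antichains \<alpha> \<Longrightarrow> x \<in> A \<Longrightarrow> y \<in> A \<Longrightarrow> (x, y) \<in> fence_le \<alpha> \<Longrightarrow> x = y"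
  by (auto simp: antichains_def)

lemma antichains_fence: "A \<in> antichains \<alpha> \<Longrightarrow> A \<subseteq> fence \<alpha>"
  by (auto simp: antichains_def)

text \<open>The complement of the ideal generated by \<open>A\<close> is an up-set. An antichain is
  the set of minimal elements of an up-set exactly when it generates it, and this generation is what
  the exclusive alternative expresses.\<close>

lemma rowmotion_eq_iff:
  assumes B: "B \<in> antichains \<alpha>"
  shows "rowmotion \<alpha> A = B \<longleftrightarrow>
    (\<forall>v\<in>fence \<alpha>. (\<exists>x\<in>A. (v, x) \<in> fence_le \<alpha>) \<noteq> (\<exists>x\<in>B. (x, v) \<in> fence_le \<alpha>))"
    (is "_ \<longleftrightarrow> ?R")
proof -
  define C where "C = fence \<alpha> - gen_ideal \<alpha> A"
  have C: "v \<in> C \<longleftrightarrow> v \<in> fence \<alpha> \<and> \<not> (\<exists>x\<in>A. (v, x) \<in> fence_le \<alpha>)" for v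
    by (auto simp: C_def gen_ideal_def)
  have C_up: "w \<in> C" if "v \<in> C" "(v, w) \<in> fence_le \<alpha>" for v w
    using that fence_le_trans fence_le_fence unfolding C by blast
  have min: "minimal_elems \<alpha> C = B \<longleftrightarrow> (\<forall>v\<in>fence \<alpha>. v \<in> C \<longleftrightarrow> (\<exists>x\<in>B. (x, v) \<in> fence_le \<alpha>))"
  proof
    assume eq: "minimal_elems \<alpha> C = B"
    have "B \<subseteq> C" using eq by (auto simp: minimal_elems_def)
    moreover have "C \<subseteq> fence \<alpha>" by (auto simp: C_def)
    ultimately show "\<forall>v\<in>fence \<alpha>. v \<in> C \<longleftrightarrow> (\<exists>x\<in>B. (x, v) \<in> fence_le \<alpha>)"
      using minimal_below[of C] C_up eq by blast
  next
    assume r: "\<forall>v\<in>fence \<alpha>. v \<in> C \<longleftrightarrow> (\<exists>x\<in>B. (x, v) \<in> fence_le \<alpha>)"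
    have BC: "B \<subseteq> C" using r antichains_fence[OF B] fence_le_refl by blast
    have CF: "C \<subseteq> fence \<alpha>" by (auto simp: C_def)
    show "minimal_elems \<alpha> C = B"
    proof
      show "minimal_elems \<alpha> C \<subseteq> B" using r BC CF unfolding minimal_elems_def by blast
      show "B \<subseteq> minimal_elems \<alpha> C"
      proof
        fix b assume b: "b \<in> B"
        have "y = b" if y: "y \<in> C" "(y, b) \<in> fence_le \<alpha>" for y
        proof -
          obtain b' where b': "b' \<in> B" "(b', y) \<in> fence_le \<alpha>" using r y CF by blast
          then have "b' = b" using antichainsD[OF B b'(1) b] fence_le_trans y by blast
          then show ?thesis using fence_le_antisym y b' by blast
        qed
        then show "b \<in> minimal_elems \<alpha> C" using b BC unfolding minimal_elems_def by blast
      qed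
    qed
  qed
  show ?thesis unfolding rowmotion_def C_def[symmetric] min using C by blast
qed

text \<open>The image determines the up-set, hence the ideal generated by \<open>A\<close>, and an
  antichain is the set of maximal elements of its ideal.\<close>

lemma inj_on_rowmotion: "inj_on (rowmotion \<alpha>) (antichains \<alpha>)"
proof (rule inj_onI)
  have sub: "A \<subseteq> A'"
    if A: "A \<in> antichains \<alpha>" "A' \<in> antichains \<alpha>" and eq: "rowmotion \<alpha> A = rowmotion \<alpha> A'" for A A'
  proof
    have I: "(\<exists>x\<in>A. (v, x) \<in> fence_le \<alpha>) \<longleftrightarrow> (\<exists>x\<in>A'. (v, x) \<in> fence_le \<alpha>)" if "v \<in> fence \<alpha>" for v
      using rowmotion_eq_iff[OF rowmotion_in_antichains, of A A'] rowmotion_eq_iff[OF rowmotion_in_antichains, of A' A'] eq that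
      by auto
    fix x assume x: "x \<in> A"
    then obtain y where y: "y \<in> A'" "(x, y) \<in> fence_le \<alpha>"
      using I[of x] antichains_fence[OF A(1)] fence_le_refl by blast
    then obtain z where z: "z \<in> A" "(y, z) \<in> fence_le \<alpha>"
      using I[of y] antichains_fence[OF A(2)] fence_le_refl by blast
    have "x = z" using antichainsD[OF A(1) x z(1)] fence_le_trans[OF y(2) z(2)] by blast
    then show "x \<in> A'" using fence_le_antisym y z by blast
  qed
  fix A A'
  assume "A \<in> antichains \<alpha>" "A' \<in> antichains \<alpha>" "rowmotion \<alpha> A = rowmotion \<alpha> A'"
  then show "A = A'" using sub[of A A'] sub[of A' A] by simp
qed

lemma finite_antichains: "finite (antichains \<alpha>)"
  by (rule finite_subset[of _ "Pow (fence \<alpha>)"]) (auto simp: antichains_def finite_fence)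

text \<open>Finiteness turns injectivity into surjectivity, which makes the \<open>inv_into\<close>
  of \<open>rowmotion_pow\<close> a genuine inverse.\<close>

lemma rowmotion_image: "rowmotion \<alpha> ` antichains \<alpha> = antichains \<alpha>"
  using endo_inj_surj[OF finite_antichains _ inj_on_rowmotion] rowmotion_in_antichains by blast

lemma inv_rowmotion:
  assumes "A \<in> antichains \<alpha>"
  shows "inv_into (antichains \<alpha>) (rowmotion \<alpha>) A \<in> antichains \<alpha>"
    and "rowmotion \<alpha> (inv_into (antichains \<alpha>) (rowmotion \<alpha>) A) = A"
  using assms rowmotion_image by (metis inv_into_into, metis f_inv_into_f)

section \<open>Bi-infinite rowmotion sequences\<close>

text \<open>An orbit unrolled along the columns. This form avoids the case distinction on the sign
  of the exponent in \<open>rowmotion_pow\<close>.\<close>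

definition walk :: "(int \<Rightarrow> nat set) \<Rightarrow> bool" where
  "walk X \<longleftrightarrow> (\<forall>k. X k \<in> antichains \<alpha> \<and> rowmotion \<alpha> (X k) = X (k + 1))"

lemma walk_antichain: "walk X \<Longrightarrow> X k \<in> antichains \<alpha>"
  by (simp add: walk_def)

lemma walk_shift: "walk X \<Longrightarrow> walk (\<lambda>k. X (k + d))"
  by (simp add: walk_def algebra_simps)

text \<open>To the right the sequence is computed by rowmotion; to the left it is determined by
  injectivity.\<close>

lemma walk_unique:
  assumes "walk X" "walk Y" "X 0 = Y 0"
  shows "X = Y"
proof
  fix k
  show "X k = Y k"
  proof (induction k rule: int_induct[where k = 0])
    case base
    then show ?case using assms(3) .
  next
    case (step1 k)
    then show ?case using assms(1,2) unfolding walk_def by metis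
  next
    case (step2 k)
    have "rowmotion \<alpha> (X (k - 1)) = rowmotion \<alpha> (Y (k - 1))"
      using assms(1,2) step2 unfolding walk_def by (metis diff_add_cancel)
    then show ?case using inj_onD[OF inj_on_rowmotion] walk_antichain assms by blast
  qed
qed

lemma rowmotion_pow_0 [simp]: "rowmotion_pow \<alpha> 0 A = A"
  by (simp add: rowmotion_pow_def)

lemma walk_rowmotion_pow:
  assumes A: "A \<in> antichains \<alpha>"
  shows "walk (\<lambda>k. rowmotion_pow \<alpha> k A)"
proof -
  define \<sigma> where "\<sigma> = inv_into (antichains \<alpha>) (rowmotion \<alpha>)"
  have pos: "(rowmotion \<alpha> ^^ n) A \<in> antichains \<alpha>" for n
    using A rowmotion_in_antichains by (cases n) auto
  have neg: "(\<sigma> ^^ n) A \<in> antichains \<alpha>" for n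
    by (induction n) (use A inv_rowmotion in \<open>auto simp: \<sigma>_def\<close>)
  have step: "rowmotion \<alpha> (rowmotion_pow \<alpha> k A) = rowmotion_pow \<alpha> (k + 1) A" for k
  proof (cases "0 \<le> k")
    case True
    then have "nat (k + 1) = Suc (nat k)" by simp
    then show ?thesis using True by (simp add: rowmotion_pow_def)
  next
    case False
    \<comment> \<open>With \<open>- k = n + 1\<close>, both exponents use the inverse, except for
      \<open>k = - 1\<close>: there \<open>k + 1 = 0\<close> falls into the other branch and
      \<open>n = 0\<close>.\<close>
    define n where "n = nat (- (k + 1))"
    have k: "nat (- k) = Suc n" using False by (simp add: n_def)
    have "rowmotion_pow \<alpha> (k + 1) A = (\<sigma> ^^ n) A"
      using False by (cases "k = - 1") (auto simp: rowmotion_pow_def n_def \<sigma>_def)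
    moreover have "rowmotion_pow \<alpha> k A = \<sigma> ((\<sigma> ^^ n) A)"
      using False by (simp add: rowmotion_pow_def k \<sigma>_def[symmetric])
    ultimately show ?thesis using inv_rowmotion(2)[OF neg[of n]] by (simp add: \<sigma>_def)
  qed
  have "rowmotion_pow \<alpha> k A \<in> antichains \<alpha>" for k
    using pos neg unfolding rowmotion_pow_def \<sigma>_def by simp
  then show ?thesis using step by (simp add: walk_def)
qed

lemma walk_eq_rowmotion_pow: "walk X \<Longrightarrow> X k = rowmotion_pow \<alpha> k (X 0)"
  using walk_unique[OF _ walk_rowmotion_pow[of "X 0"]] walk_antichain by (metis rowmotion_pow_0)

text \<open>A shifted walk is again a walk, so it is given by the powers applied to its own column
  \<open>0\<close>.\<close>

lemma rowmotion_pow_add: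
  assumes "A \<in> antichains \<alpha>"
  shows "rowmotion_pow \<alpha> (k + d) A = rowmotion_pow \<alpha> k (rowmotion_pow \<alpha> d A)"
  using walk_eq_rowmotion_pow[OF walk_shift[OF walk_rowmotion_pow[OF assms], of d]] by simp

section \<open>Rowmotion, segment by segment\<close>

text \<open>Any two elements of a common segment are comparable, and comparable elements share a
  segment.\<close>

lemma antichains_iff:
  assumes "A \<subseteq> fence \<alpha>"
  shows "A \<in> antichains \<alpha> \<longleftrightarrow>
    (\<forall>i\<in>{1..s}. \<forall>j\<le>a i. \<forall>j'\<le>a i. elem i j \<in> A \<longrightarrow> elem i j' \<in> A \<longrightarrow> j = j')" (is "_ \<longleftrightarrow> ?R")
proof
  assume A: "A \<in> antichains \<alpha>"
  show ?R
  proof (intro ballI allI impI)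
    fix i j j'
    assume i: "i \<in> {1..s}" and j: "j \<le> a i" "j' \<le> a i" "elem i j \<in> A" "elem i j' \<in> A"
    have "(elem i j, elem i j') \<in> fence_le \<alpha> \<or> (elem i j', elem i j) \<in> fence_le \<alpha>"
      unfolding fence_le_iff using assms i j nat_le_linear[of j j'] by blast
    then have "elem i j = elem i j'" using antichainsD[OF A] j by metis
    then show "j = j'" using elem_inj i j by simp
  qed
next
  assume R: ?R
  have "x = y" if xy: "x \<in> A" "y \<in> A" "(x, y) \<in> fence_le \<alpha>" for x y
  proof -
    obtain i j j' where i: "i \<in> {1..s}" and j: "j \<le> j'" "j' \<le> a i" "x = elem i j" "y = elem i j'"
      using xy(3) unfolding fence_le_iff by blast
    have "j = j'" using R[rule_format, of i j j'] i j xy by simp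
    then show ?thesis using j by simp
  qed
  then show "A \<in> antichains \<alpha>" using assms by (auto simp: antichains_def)
qed

lemma inner_le_iff:
  assumes "1 \<le> i" "i \<le> s" "1 \<le> j" "j < a i"
  shows "(elem i j, x) \<in> fence_le \<alpha> \<longleftrightarrow> x \<in> fence \<alpha> \<and> (\<exists>j'\<in>{j..a i}. x = elem i j')" (is "_ \<longleftrightarrow> ?R")
proof
  assume "(elem i j, x) \<in> fence_le \<alpha>"
  then obtain i' j' k where *: "x \<in> fence \<alpha>" "i' \<in> {1..s}" "j' \<le> a i'" "k \<le> j'" "elem i j = elem i' k" "x = elem i' j'"
    unfolding fence_le_iff by blast
  then show ?R using elem_eq_inner[of i j i' k] assms by auto
next
  assume ?R
  then obtain j' where "x \<in> fence \<alpha>" "j \<le> j'" "j' \<le> a i" "x = elem i j'" by auto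
  moreover have "i \<in> {1..s}" using assms by simp
  ultimately show "(elem i j, x) \<in> fence_le \<alpha>"
    unfolding fence_le_iff using elem_in_fence[OF assms] by blast
qed

lemma le_inner_iff:
  assumes "1 \<le> i" "i \<le> s" "1 \<le> j" "j < a i"
  shows "(x, elem i j) \<in> fence_le \<alpha> \<longleftrightarrow> x \<in> fence \<alpha> \<and> (\<exists>j'\<le>j. x = elem i j')" (is "_ \<longleftrightarrow> ?R")
proof
  assume "(x, elem i j) \<in> fence_le \<alpha>"
  then obtain i' j' k where *: "x \<in> fence \<alpha>" "i' \<in> {1..s}" "j' \<le> a i'" "k \<le> j'" "x = elem i' k" "elem i j = elem i' j'"
    unfolding fence_le_iff by blast
  then show ?R using elem_eq_inner[of i j i' j'] assms by auto
next
  assume ?R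
  then obtain j' where "x \<in> fence \<alpha>" "j' \<le> j" "x = elem i j'" by blast
  moreover have "i \<in> {1..s}" "j \<le> a i" using assms by simp_all
  ultimately show "(x, elem i j) \<in> fence_le \<alpha>"
    unfolding fence_le_iff using elem_in_fence[OF assms] by blast
qed

text \<open>For even \<open>l\<close> the element is minimal in the fence and everything above it
  lies in the two segments that it joins; for odd \<open>l\<close> it is maximal.\<close>

lemma psum_le_iff:
  assumes "1 \<le> l" "l < s"
  shows "(p l, x) \<in> fence_le \<alpha> \<longleftrightarrow> (if even l then x \<in> segment \<alpha> l \<union> segment \<alpha> (l + 1) else x = p l)" (is "_ \<longleftrightarrow> ?R")
proof
  assume "(p l, x) \<in> fence_le \<alpha>"
  then obtain i j j' where *: "x \<in> fence \<alpha>" "i \<in> {1..s}" "j' \<le> a i" "j \<le> j'" "p l = elem i j" "x = elem i j'"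
    unfolding fence_le_iff by blast
  have i: "i = l \<or> i = l + 1" "j = (if even l then 0 else a i)"
    using elem_eq_psum[OF assms, of i j] * by auto
  show ?R using i * segment_iff[of i x] assms by (auto split: if_splits)
next
  assume R: ?R
  show "(p l, x) \<in> fence_le \<alpha>"
  proof (cases "even l")
    case True
    then obtain i where i: "i = l \<or> i = l + 1" "x \<in> segment \<alpha> i" using R by auto
    obtain j where j: "x \<in> fence \<alpha>" "j \<le> a i" "x = elem i j" using i segment_iff[of i x] assms by auto
    have "p l = elem i 0" "i \<in> {1..s}" using elem_end[of l i] True i assms by auto
    then show ?thesis unfolding fence_le_iff using psum_in_fence[OF assms] j by blast
  next
    case False
    then show ?thesis using R fence_le_refl psum_in_fence[OF assms] by simp
  qed
qed

lemma le_psum_iff: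
  assumes "1 \<le> l" "l < s"
  shows "(x, p l) \<in> fence_le \<alpha> \<longleftrightarrow> (if odd l then x \<in> segment \<alpha> l \<union> segment \<alpha> (l + 1) else x = p l)" (is "_ \<longleftrightarrow> ?R")
proof
  assume "(x, p l) \<in> fence_le \<alpha>"
  then obtain i j j' where *: "x \<in> fence \<alpha>" "i \<in> {1..s}" "j' \<le> a i" "j \<le> j'" "p l = elem i j'" "x = elem i j"
    unfolding fence_le_iff by blast
  have i: "i = l \<or> i = l + 1" "j' = (if even l then 0 else a i)"
    using elem_eq_psum[OF assms, of i j'] * by auto
  show ?R using i * segment_iff[of i x] assms by (auto split: if_splits)
next
  assume R: ?R
  show "(x, p l) \<in> fence_le \<alpha>"
  proof (cases "odd l")
    case True
    then obtain i where i: "i = l \<or> i = l + 1" "x \<in> segment \<alpha> i" using R by auto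
    obtain j where j: "x \<in> fence \<alpha>" "j \<le> a i" "x = elem i j" using i segment_iff[of i x] assms by auto
    have "p l = elem i (a i)" "i \<in> {1..s}" using elem_end[of l i] True i assms by auto
    then show ?thesis unfolding fence_le_iff using psum_in_fence[OF assms] j by blast
  next
    case False
    then show ?thesis using R fence_le_refl psum_in_fence[OF assms] by simp
  qed
qed

text \<open>The criterion \<open>rowmotion_eq_iff\<close> at the unshared elements of one segment.
  All elements comparable to these lie in the same segment, so the rows separate.\<close>

definition row_step :: "nat \<Rightarrow> nat set \<Rightarrow> nat set \<Rightarrow> bool" where
  "row_step i A B \<longleftrightarrow> (\<forall>j\<in>{1..<a i}. (\<exists>j'\<in>{j..a i}. elem i j' \<in> A) \<noteq> (\<exists>j'\<le>j. elem i j' \<in> B))"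

text \<open>The same criterion at a shared element. At a minimum, being above an element of
  \<open>B\<close> reduces to membership in \<open>B\<close>; at a maximum, being below an element
  of \<open>A\<close> reduces to membership in \<open>A\<close>.\<close>

definition shared_step :: "nat \<Rightarrow> nat set \<Rightarrow> nat set \<Rightarrow> bool" where
  "shared_step l A B \<longleftrightarrow>
    (if even l then p l \<in> B \<longleftrightarrow> A \<inter> segment \<alpha> l = {} \<and> A \<inter> segment \<alpha> (l + 1) = {}
     else p l \<in> A \<longleftrightarrow> B \<inter> segment \<alpha> l = {} \<and> B \<inter> segment \<alpha> (l + 1) = {})"

lemma rowmotion_iff_steps:
  assumes A: "A \<subseteq> fence \<alpha>" and B: "B \<in> antichains \<alpha>"
  shows "rowmotion \<alpha> A = B \<longleftrightarrow> (\<forall>i\<in>{1..s}. row_step i A B) \<and> (\<forall>l\<in>{1..<s}. shared_step l A B)"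
proof -
  have BF: "B \<subseteq> fence \<alpha>" using antichains_fence[OF B] .
  let ?P = "\<lambda>v. (\<exists>x\<in>A. (v, x) \<in> fence_le \<alpha>) \<noteq> (\<exists>x\<in>B. (x, v) \<in> fence_le \<alpha>)"
  have "(\<forall>v\<in>fence \<alpha>. ?P v) \<longleftrightarrow>
      (\<forall>i\<in>{1..s}. \<forall>j\<in>{1..<a i}. ?P (elem i j)) \<and> (\<forall>l\<in>{1..<s}. ?P (p l))"
  proof
    assume "\<forall>v\<in>fence \<alpha>. ?P v"
    then show "(\<forall>i\<in>{1..s}. \<forall>j\<in>{1..<a i}. ?P (elem i j)) \<and> (\<forall>l\<in>{1..<s}. ?P (p l))"
      using elem_in_fence psum_in_fence by simp
  next
    assume r: "(\<forall>i\<in>{1..s}. \<forall>j\<in>{1..<a i}. ?P (elem i j)) \<and> (\<forall>l\<in>{1..<s}. ?P (p l))"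
    show "\<forall>v\<in>fence \<alpha>. ?P v"
    proof
      fix v assume "v \<in> fence \<alpha>"
      then show "?P v" by (cases rule: fence_cases) (use r in auto)
    qed
  qed
  moreover have "?P (elem i j) \<longleftrightarrow> (\<exists>j'\<in>{j..a i}. elem i j' \<in> A) \<noteq> (\<exists>j'\<le>j. elem i j' \<in> B)"
    if "i \<in> {1..s}" "j \<in> {1..<a i}" for i j
  proof -
    have h: "1 \<le> i" "i \<le> s" "1 \<le> j" "j < a i" using that by simp_all
    have "(\<exists>x\<in>A. (elem i j, x) \<in> fence_le \<alpha>) \<longleftrightarrow> (\<exists>j'\<in>{j..a i}. elem i j' \<in> A)"
      unfolding inner_le_iff[OF h] using A by blast
    moreover have "(\<exists>x\<in>B. (x, elem i j) \<in> fence_le \<alpha>) \<longleftrightarrow> (\<exists>j'\<le>j. elem i j' \<in> B)"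
      unfolding le_inner_iff[OF h] using BF by blast
    ultimately show ?thesis by simp
  qed
  moreover have "?P (p l) \<longleftrightarrow> shared_step l A B" if "l \<in> {1..<s}" for l
  proof -
    have l: "1 \<le> l" "l < s" using that by simp_all
    show ?thesis
      unfolding shared_step_def psum_le_iff[OF l] le_psum_iff[OF l] by (cases "even l") auto
  qed
  ultimately show ?thesis unfolding rowmotion_eq_iff[OF B] row_step_def by simp
qed

section \<open>Tilings as sequences of antichains\<close>

text \<open>The tile which shows, on the square \<open>(i, k)\<close>, that the antichain in column \<open>k\<close> contains
  \<open>elem i j\<close>.\<close>

definition tile_at :: "nat \<Rightarrow> nat \<Rightarrow> int \<Rightarrow> tile" where
  "tile_at i j k =
    (if j = 0 then Red (if odd i then i - 1 else i) k
     else if j = a i then Red (if odd i then i else i - 1) k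
     else Black i (k - int j + 1))"

text \<open>Apart from the yellow tile, the tiles through a square are indexed by the heights of the
  segment. Thus covering a square amounts to choosing a height or none.\<close>

lemma covering_tiles:
  assumes "1 \<le> i" "i \<le> s"
  shows "(i, k) \<in> squares \<alpha> t \<longleftrightarrow> t = Yellow i k \<or> (\<exists>j\<le>a i. t = tile_at i j k)"
proof
  assume t: "(i, k) \<in> squares \<alpha> t"
  show "t = Yellow i k \<or> (\<exists>j\<le>a i. t = tile_at i j k)"
  proof (cases t)
    case (Yellow i' k')
    then show ?thesis using t by simp
  next
    case (Red l k')
    then have l: "i = l \<or> i = l + 1" "k' = k" using t by auto
    have "t = tile_at i (if even l then 0 else a i) k"
      using l Red part_pos[OF assms] by (auto simp: tile_at_def)
    then show ?thesis by (metis le_refl zero_le)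
  next
    case (Black i' k')
    then have b: "i' = i" "k' \<le> k" "k < k' + (int (a i) - 1)" using t by auto
    \<comment> \<open>The first square of a black tile has height \<open>1\<close>, so the square in
      column \<open>k\<close> has height \<open>k - k' + 1\<close>.\<close>
    define j where "j = nat (k - k') + 1"
    have "j \<le> a i" "t = tile_at i j k"
      using b Black by (auto simp: j_def tile_at_def)
    then show ?thesis by blast
  qed
next
  assume "t = Yellow i k \<or> (\<exists>j\<le>a i. t = tile_at i j k)"
  then show "(i, k) \<in> squares \<alpha> t" using assms by (auto simp: tile_at_def)
qed

lemma tile_at_inj:
  assumes "1 \<le> i" "i \<le> s" "j \<le> a i" "j' \<le> a i" "tile_at i j k = tile_at i j' k"
  shows "j = j'"
  using assms part_pos[OF assms(1,2)] by (auto simp: tile_at_def split: if_splits)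

lemma tile_at_neq_Yellow: "tile_at i j k \<noteq> Yellow i' k'"
  by (simp add: tile_at_def)

lemma tile_at_end:
  assumes "i = l \<or> i = l + 1" "1 \<le> i" "i \<le> s"
  shows "tile_at i (if even l then 0 else a i) k = Red l k"
  using assms(1) part_pos[OF assms(2,3)] by (auto simp: tile_at_def)

lemma tile_at_inner: "1 \<le> j \<Longrightarrow> j < a i \<Longrightarrow> tile_at i j k = Black i (k - int j + 1)"
  by (simp add: tile_at_def)

lemma tile_at_slide: "1 \<le> j \<Longrightarrow> j + 1 < a i \<Longrightarrow> tile_at i (j + 1) (k + 1) = tile_at i j k"
  by (simp add: tile_at_def)

text \<open>A shared element is read in two rows, and both readings must name the same red tile for
  \<open>columns\<close> to be consistent.\<close>

lemma tile_at_cong: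
  assumes "1 \<le> i" "i \<le> s" "j \<le> a i" "1 \<le> i'" "i' \<le> s" "j' \<le> a i'"
    and "elem i j = elem i' j'" "elem i j \<in> fence \<alpha>"
  shows "tile_at i j k = tile_at i' j' k"
  using assms(1-3,8)
proof (cases rule: elem_fence_cases)
  case 1
  then show ?thesis using elem_eq_inner[of i j i' j'] assms by simp
next
  case (2 l)
  then have "(i' = l \<or> i' = l + 1) \<and> j' = (if even l then 0 else a i')"
    using elem_eq_psum[OF 2(1,2) assms(4-6)] assms(7) by simp
  then show ?thesis using tile_at_end[of i l k] tile_at_end[of i' l k] 2 assms by metis
qed

definition valid_tile :: "tile \<Rightarrow> bool" where
  "valid_tile t \<longleftrightarrow> squares \<alpha> t \<noteq> {} \<and> squares \<alpha> t \<subseteq> strip \<alpha>"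

text \<open>The fictitious ends \<open>p 0\<close> and \<open>p s\<close> correspond to red tiles
  sticking out above row \<open>1\<close> or below row \<open>s\<close>.\<close>

lemma valid_tile_at:
  assumes "1 \<le> i" "i \<le> s" "j \<le> a i"
  shows "valid_tile (tile_at i j k) \<longleftrightarrow> elem i j \<in> fence \<alpha>"
proof (cases "1 \<le> j \<and> j < a i")
  case True
  then have "valid_tile (tile_at i j k)"
    using assms by (auto simp: valid_tile_def tile_at_inner strip_def)
  then show ?thesis using True elem_in_fence assms by simp
next
  case False
  then obtain l where l: "l = i - 1 \<or> l = i" "j = (if even l then 0 else a i)"
  proof -
    have "j = 0 \<or> j = a i" using False assms by linarith
    moreover have "even (i - 1) \<longleftrightarrow> odd i" using assms by simp
    ultimately show ?thesis using that[of i] that[of "i - 1"] by (cases "even i") auto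
  qed
  have i: "i = l \<or> i = l + 1" using l assms by auto
  have "tile_at i j k = Red l k" using tile_at_end[OF i assms(1,2)] l by simp
  then have v: "valid_tile (tile_at i j k) \<longleftrightarrow> 1 \<le> l \<and> l < s"
    by (auto simp: valid_tile_def strip_def)
  have "elem i j = p l"
  proof (cases "l = 0")
    case True
    then have "i = 1 \<and> j = 0" using l i assms by auto
    then show ?thesis using True by (simp add: elem_def)
  next
    case False
    then show ?thesis using elem_end[OF _ i] l by simp
  qed
  moreover have "p l \<in> fence \<alpha> \<longleftrightarrow> 1 \<le> l \<and> l < s"
  proof -
    have "l = 0 \<or> l = s \<or> (1 \<le> l \<and> l < s)" using l assms by linarith
    then show ?thesis using psum_in_fence[of l] psum_ends_notin_fence by auto
  qed
  ultimately show ?thesis using v by simp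
qed

section \<open>Correspondence between tile sets and column sequences\<close>

text \<open>Neither a tiling nor antichains are required here, so that each tiling condition on
  \<open>T\<close> can be translated separately into a condition on \<open>X\<close>.\<close>

definition displays :: "tile set \<Rightarrow> (int \<Rightarrow> nat set) \<Rightarrow> bool" where
  "displays T X \<longleftrightarrow> (\<forall>t\<in>T. valid_tile t) \<and> (\<forall>k. X k \<subseteq> fence \<alpha>) \<and>
    (\<forall>i\<in>{1..s}. \<forall>k. (Yellow i k \<in> T \<longleftrightarrow> (\<forall>j\<le>a i. elem i j \<notin> X k)) \<and>
       (\<forall>j\<le>a i. tile_at i j k \<in> T \<longleftrightarrow> elem i j \<in> X k))"

lemma displays_yellow:
  "displays T X \<Longrightarrow> 1 \<le> i \<Longrightarrow> i \<le> s \<Longrightarrow> Yellow i k \<in> T \<longleftrightarrow> (\<forall>j\<le>a i. elem i j \<notin> X k)"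
  by (simp add: displays_def)

lemma displays_elem:
  "displays T X \<Longrightarrow> 1 \<le> i \<Longrightarrow> i \<le> s \<Longrightarrow> j \<le> a i \<Longrightarrow> tile_at i j k \<in> T \<longleftrightarrow> elem i j \<in> X k"
  by (simp add: displays_def)

lemma displays_fence: "displays T X \<Longrightarrow> X k \<subseteq> fence \<alpha>"
  by (simp add: displays_def)

lemma displays_red:
  assumes "displays T X" "1 \<le> l" "l < s"
  shows "Red l k \<in> T \<longleftrightarrow> p l \<in> X k"
  using displays_elem[OF assms(1), of l "if even l then 0 else a l" k]
    tile_at_end[of l l k] elem_end[of l l] assms by (auto split: if_splits)

lemma segment_disjoint_iff:
  assumes "A \<subseteq> fence \<alpha>" "1 \<le> i"
  shows "A \<inter> segment \<alpha> i = {} \<longleftrightarrow> (\<forall>j\<le>a i. elem i j \<notin> A)"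
proof -
  have "A \<inter> segment \<alpha> i = {} \<longleftrightarrow> (\<forall>x\<in>A. \<forall>j\<le>a i. x \<noteq> elem i j)"
    unfolding disjoint_iff segment_iff[OF assms(2)] using assms(1) by auto
  then show ?thesis by auto
qed

text \<open>Every square is covered, because yellow fills the columns where the segment is missed.
  Double covering means that one segment is met at two heights.\<close>

lemma is_tiling_iff:
  assumes D: "displays T X"
  shows "is_tiling \<alpha> T \<longleftrightarrow> (\<forall>k. X k \<in> antichains \<alpha>)"
proof -
  have "(\<exists>!t. t \<in> T \<and> (i, k) \<in> squares \<alpha> t) \<longleftrightarrow>
      (\<forall>j\<le>a i. \<forall>j'\<le>a i. elem i j \<in> X k \<longrightarrow> elem i j' \<in> X k \<longrightarrow> j = j')" (is "?L \<longleftrightarrow> ?R")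
    if i: "1 \<le> i" "i \<le> s" for i k
  proof
    assume L: ?L
    show ?R
    proof (intro allI impI)
      fix j j' assume j: "j \<le> a i" "j' \<le> a i" "elem i j \<in> X k" "elem i j' \<in> X k"
      then have "tile_at i j k \<in> T" "tile_at i j' k \<in> T" using displays_elem[OF D i] by simp_all
      then have "tile_at i j k = tile_at i j' k" using L covering_tiles[OF i] j by blast
      then show "j = j'" using tile_at_inj[OF i] j by blast
    qed
  next
    assume R: ?R
    show ?L
    proof (cases "Yellow i k \<in> T")
      case True
      then have "tile_at i j k \<notin> T" if "j \<le> a i" for j
        using displays_yellow[OF D i] displays_elem[OF D i] that by blast
      then show ?thesis
        using True by (intro ex1I[of _ "Yellow i k"]) (auto simp: covering_tiles[OF i])
    next
      case False
      then obtain j where j: "j \<le> a i" "elem i j \<in> X k" using displays_yellow[OF D i] by blast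
      show ?thesis
      proof (rule ex1I)
        show "tile_at i j k \<in> T \<and> (i, k) \<in> squares \<alpha> (tile_at i j k)"
          using displays_elem[OF D i] covering_tiles[OF i] j by blast
        fix t assume t: "t \<in> T \<and> (i, k) \<in> squares \<alpha> t"
        then obtain j' where j': "j' \<le> a i" "t = tile_at i j' k"
          using covering_tiles[OF i] False by metis
        then have "j' = j" using R displays_elem[OF D i j'(1)] t j by metis
        then show "t = tile_at i j k" using j' by simp
      qed
    qed
  qed
  then have "(\<forall>q\<in>strip \<alpha>. \<exists>!t. t \<in> T \<and> q \<in> squares \<alpha> t) \<longleftrightarrow>
      (\<forall>k. \<forall>i\<in>{1..s}. \<forall>j\<le>a i. \<forall>j'\<le>a i. elem i j \<in> X k \<longrightarrow> elem i j' \<in> X k \<longrightarrow> j = j')"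
    unfolding strip_def by force
  moreover have "\<forall>t\<in>T. squares \<alpha> t \<noteq> {} \<and> squares \<alpha> t \<subseteq> strip \<alpha>"
    using D by (auto simp: displays_def valid_tile_def)
  ultimately show ?thesis
    unfolding is_tiling_def using antichains_iff[OF displays_fence[OF D]] by simp
qed

lemma red_condition_iff:
  assumes D: "displays T X" and l: "1 \<le> l" "l < s"
  shows "red_condition T l \<longleftrightarrow> (\<forall>k. shared_step l (X k) (X (k + 1)))"
proof -
  have Y: "Yellow i k \<in> T \<longleftrightarrow> X k \<inter> segment \<alpha> i = {}" if "i = l \<or> i = l + 1" for i k
    using displays_yellow[OF D, of i k] segment_disjoint_iff[OF displays_fence[OF D], of i k] that l by auto
  show ?thesis
  proof (cases "even l")
    case True
    \<comment> \<open>For even \<open>l\<close> the red tile lies one column after the yellow pair;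
      reindexing makes \<open>k\<close> the earlier column, as in
      \<open>shared_step\<close>.\<close>
    have shift: "(\<forall>k. P k) \<longleftrightarrow> (\<forall>k. P (k + 1))" for P :: "int \<Rightarrow> bool"
      by (metis diff_add_cancel)
    have "red_condition T l \<longleftrightarrow> (\<forall>k. Red l (k + 1) \<in> T \<longleftrightarrow> Yellow l k \<in> T \<and> Yellow (l + 1) k \<in> T)"
      unfolding red_condition_def by (subst shift) (simp add: True)
    then show ?thesis using True Y displays_red[OF D l] by (simp add: shared_step_def)
  next
    case False
    then show ?thesis using Y displays_red[OF D l] by (simp add: shared_step_def red_condition_def)
  qed
qed

text \<open>This supplies \<open>low\<close> and \<open>high\<close>: a bottom inside the fence is
  some \<open>p l\<close> with \<open>l\<close> even, a top one with \<open>l\<close> odd, and the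
  shared step there empties the segment in the neighbouring column.\<close>

lemma shared_steps_ends:
  assumes A: "A \<subseteq> fence \<alpha>" and B: "B \<subseteq> fence \<alpha>"
    and st: "\<forall>l\<in>{1..<s}. shared_step l A B" and i: "1 \<le> i" "i \<le> s" "j \<le> a i"
  shows "elem i 0 \<in> B \<Longrightarrow> elem i j \<notin> A" and "elem i (a i) \<in> A \<Longrightarrow> elem i j \<notin> B"
proof -
  show "elem i j \<notin> A" if e: "elem i 0 \<in> B"
  proof -
    obtain l where l: "1 \<le> l" "l < s" "i = l \<or> i = l + 1" "0 = (if even l then 0 else a i)" "elem i 0 = p l"
      by (rule elem_fence_cases[of i 0]) (use e B i in auto)
    have "even l" using l part_pos[OF i(1,2)] by (auto split: if_splits)
    then have "A \<inter> segment \<alpha> i = {}" using st l e by (auto simp: shared_step_def)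
    then show ?thesis using segment_disjoint_iff[OF A i(1)] i by blast
  qed
  show "elem i j \<notin> B" if e: "elem i (a i) \<in> A"
  proof -
    obtain l where l: "1 \<le> l" "l < s" "i = l \<or> i = l + 1" "a i = (if even l then 0 else a i)" "elem i (a i) = p l"
      by (rule elem_fence_cases[of i "a i"]) (use e A i in auto)
    have "odd l" using l part_pos[OF i(1,2)] by (auto split: if_splits)
    then have "B \<inter> segment \<alpha> i = {}" using st l e by (auto simp: shared_step_def)
    then show ?thesis using segment_disjoint_iff[OF B i(1)] i by blast
  qed
qed

text \<open>The assumption \<open>slide\<close> of \<open>row\<close> is automatic here: consecutive
  inner heights in consecutive columns are witnessed by the very same black tile.\<close>

lemma alternating_row_iff:
  assumes D: "displays T X" and anti: "\<And>k. X k \<in> antichains \<alpha>"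
    and st: "\<And>k. \<forall>l\<in>{1..<s}. shared_step l (X k) (X (k + 1))"
    and i: "1 \<le> i" "i \<le> s" "1 < a i"
  shows "alternating_row T i \<longleftrightarrow> (\<forall>k. row_step i (X k) (X (k + 1)))"
proof -
  interpret row "a i" "\<lambda>j k. elem i j \<in> X k"
  proof
    show "2 \<le> a i" using i by simp
  next
    fix j j' k
    assume "elem i j \<in> X k" "elem i j' \<in> X k" "j \<le> a i" "j' \<le> a i"
    then show "j = j'" using antichains_iff[OF displays_fence[OF D], of k] anti i by auto
  next
    fix j k
    assume j: "1 \<le> j" "j + 1 < a i"
    then have "tile_at i j k \<in> T \<longleftrightarrow> tile_at i (j + 1) (k + 1) \<in> T" using tile_at_slide by simp
    then show "elem i j \<in> X k \<longleftrightarrow> elem i (j + 1) \<in> X (k + 1)"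
      using displays_elem[OF D i(1,2)] j by simp
  next
    fix j k
    assume "elem i 0 \<in> X k" "j \<le> a i"
    then show "elem i j \<notin> X (k - 1)"
      using shared_steps_ends(1)[OF displays_fence[OF D] displays_fence[OF D] st, of i j "k - 1"] i by simp
  next
    fix j k
    assume "elem i (a i) \<in> X k" "j \<le> a i"
    then show "elem i j \<notin> X (k + 1)"
      using shared_steps_ends(2)[OF displays_fence[OF D] displays_fence[OF D] st, of i j k] i by simp
  qed
  have yellow: "Yellow i k \<in> T \<longleftrightarrow> Y k" for k
    using displays_yellow[OF D i(1,2)] by (simp add: Y_def)
  have black: "Black i k \<in> T \<longleftrightarrow> elem i 1 \<in> X k" for k
    using displays_elem[OF D i(1,2), of 1 k] i by (simp add: tile_at_inner)
  have "alternating_row T i \<longleftrightarrow> alternating"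
    unfolding alternating_row_def alternating_def non_red_at_def N_def yellow black ..
  moreover have "steps \<longleftrightarrow> (\<forall>k. row_step i (X k) (X (k + 1)))"
    by (simp add: steps_def row_step_def)
  ultimately show ?thesis using steps_iff_alternating by simp
qed

lemma alpha_tilings_iff_walk:
  assumes D: "displays T X"
  shows "T \<in> alpha_tilings \<alpha> \<longleftrightarrow> walk X"
proof -
  \<comment> \<open>A segment with \<open>a i = 1\<close> has no unshared elements, which matches
    the exemption of such rows from alternation.\<close>
  have row1: "row_step i A B" if "\<not> 1 < a i" for i A B
    using that by (simp add: row_step_def)
  have red: "(\<forall>l. 1 \<le> l \<and> l < s \<longrightarrow> red_condition T l) \<longleftrightarrow>
      (\<forall>k. \<forall>l\<in>{1..<s}. shared_step l (X k) (X (k + 1)))"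
    using red_condition_iff[OF D] by auto
  have "T \<in> alpha_tilings \<alpha> \<longleftrightarrow> (\<forall>k. X k \<in> antichains \<alpha>) \<and>
      (\<forall>i. 1 \<le> i \<and> i \<le> s \<and> 1 < a i \<longrightarrow> alternating_row T i) \<and>
      (\<forall>k. \<forall>l\<in>{1..<s}. shared_step l (X k) (X (k + 1)))"
    unfolding alpha_tilings_def mem_Collect_eq is_tiling_iff[OF D] red ..
  also have "\<dots> \<longleftrightarrow> (\<forall>k. X k \<in> antichains \<alpha>) \<and>
      (\<forall>k. \<forall>i\<in>{1..s}. row_step i (X k) (X (k + 1))) \<and>
      (\<forall>k. \<forall>l\<in>{1..<s}. shared_step l (X k) (X (k + 1)))"
  proof -
    \<comment> \<open>The row equivalence holds only in the presence of the antichain and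
      shared-step conditions, so it is applied under these other conjuncts.\<close>
    have "(\<forall>i. 1 \<le> i \<and> i \<le> s \<and> 1 < a i \<longrightarrow> alternating_row T i) \<longleftrightarrow>
        (\<forall>k. \<forall>i\<in>{1..s}. row_step i (X k) (X (k + 1)))"
      if "\<forall>k. X k \<in> antichains \<alpha>" "\<forall>k. \<forall>l\<in>{1..<s}. shared_step l (X k) (X (k + 1))"
      using alternating_row_iff[OF D] that row1 by (metis atLeastAtMost_iff)
    then show ?thesis by blast
  qed
  also have "\<dots> \<longleftrightarrow> walk X"
    unfolding walk_def using rowmotion_iff_steps[OF displays_fence[OF D]] by blast
  finally show ?thesis .
qed

text \<open>Validity makes each tile cover some square of the strip, and every tile through such a
  square is controlled by the sequence.\<close>

lemma displays_tile_unique: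
  assumes "displays T X" "displays T' X"
  shows "T = T'"
proof -
  have "T \<subseteq> T'" if D: "displays T X" "displays T' X" for T T'
  proof
    fix t assume t: "t \<in> T"
    then have "valid_tile t" using D by (simp add: displays_def)
    then obtain i k where ik: "(i, k) \<in> squares \<alpha> t" "1 \<le> i" "i \<le> s"
      unfolding valid_tile_def strip_def by fastforce
    then consider "t = Yellow i k" | j where "j \<le> a i" "t = tile_at i j k"
      using covering_tiles by blast
    then show "t \<in> T'"
      using displays_yellow[OF D(1) ik(2,3)] displays_yellow[OF D(2) ik(2,3)]
        displays_elem[OF D(1) ik(2,3)] displays_elem[OF D(2) ik(2,3)] t by cases auto
  qed
  then show ?thesis using assms by blast
qed

lemma displays_sequence_unique:
  assumes "displays T X" "displays T Z"
  shows "X = Z"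
proof -
  have "x \<in> X k \<longleftrightarrow> x \<in> Z k" if "x \<in> fence \<alpha>" for x k
    using that
  proof (cases rule: fence_cases)
    case (1 i j)
    then show ?thesis using displays_elem[OF assms(1), of i j k] displays_elem[OF assms(2), of i j k] by simp
  next
    case (2 l)
    then show ?thesis using displays_red[OF assms(1)] displays_red[OF assms(2)] by simp
  qed
  then show ?thesis using displays_fence assms by blast
qed

definition columns :: "tile set \<Rightarrow> int \<Rightarrow> nat set" where
  "columns T k = {x \<in> fence \<alpha>. \<exists>i\<in>{1..s}. \<exists>j\<le>a i. x = elem i j \<and> tile_at i j k \<in> T}"

lemma displays_columns:
  assumes T: "is_tiling \<alpha> T"
  shows "displays T (columns T)"
proof -
  have valid: "\<forall>t\<in>T. valid_tile t" using T by (simp add: is_tiling_def valid_tile_def)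
  have el: "tile_at i j k \<in> T \<longleftrightarrow> elem i j \<in> columns T k"
    if i: "1 \<le> i" "i \<le> s" "j \<le> a i" for i j k
  proof
    assume "tile_at i j k \<in> T"
    then show "elem i j \<in> columns T k"
      using valid_tile_at[OF i] valid i unfolding columns_def by auto
  next
    assume "elem i j \<in> columns T k"
    then obtain i' j' where "i' \<in> {1..s}" "j' \<le> a i'" "elem i j = elem i' j'" "tile_at i' j' k \<in> T" "elem i j \<in> fence \<alpha>"
      unfolding columns_def by blast
    then show "tile_at i j k \<in> T" using tile_at_cong[OF i, of i' j' k] by simp
  qed
  have "Yellow i k \<in> T \<longleftrightarrow> (\<forall>j\<le>a i. tile_at i j k \<notin> T)" if i: "1 \<le> i" "i \<le> s" for i k
  proof -
    have "\<exists>!t. t \<in> T \<and> (i, k) \<in> squares \<alpha> t" using T i by (auto simp: is_tiling_def strip_def)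
    then show ?thesis using covering_tiles[OF i] tile_at_neq_Yellow by metis
  qed
  then show ?thesis
    using valid el unfolding displays_def by (auto simp: columns_def)
qed

section \<open>The tiling of an orbit\<close>

lemma psum_in_segment:
  assumes "1 \<le> l" "l < s" "i = l \<or> i = l + 1"
  shows "p l \<in> segment \<alpha> i"
  using assms psum_in_fence[OF assms(1,2)] psum_mono[of "l - 1" l] psum_mono[of l "l + 1"]
  by (auto simp: segment_def)

lemma segment_Int_Suc:
  assumes "1 \<le> l" "l < s"
  shows "segment \<alpha> l \<inter> segment \<alpha> (l + 1) = {p l}"
  using psum_in_segment[OF assms] by (auto simp: segment_def)

lemma shared_eq: "shared \<alpha> = p ` {1..<s}"
proof
  show "shared \<alpha> \<subseteq> p ` {1..<s}"
  proof
    fix x assume "x \<in> shared \<alpha>"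
    then obtain i i' where i: "i \<in> {1..s}" "i' \<in> {1..s}" "x \<in> segment \<alpha> i" "x \<in> segment \<alpha> i'" "i \<noteq> i'"
      unfolding shared_def by blast
    then show "x \<in> p ` {1..<s}" using segment_eq_or_end[OF i] by auto
  qed
  show "p ` {1..<s} \<subseteq> shared \<alpha>"
  proof
    fix x assume "x \<in> p ` {1..<s}"
    then obtain l where l: "1 \<le> l" "l < s" "x = p l" by auto
    then have "x \<in> segment \<alpha> l" "x \<in> segment \<alpha> (l + 1)" using psum_in_segment by simp_all
    moreover have "l \<in> {1..s}" "l + 1 \<in> {1..s}" "l \<noteq> l + 1" using l by simp_all
    ultimately show "x \<in> shared \<alpha>" unfolding shared_def by blast
  qed
qed

lemma unshared_in_eq:
  assumes i: "1 \<le> i" "i \<le> s"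
  shows "unshared_in \<alpha> i = elem i ` {1..<a i}"
proof
  show "unshared_in \<alpha> i \<subseteq> elem i ` {1..<a i}"
  proof
    fix x assume x: "x \<in> unshared_in \<alpha> i"
    then obtain j where j: "j \<le> a i" "x = elem i j" "x \<in> fence \<alpha>"
      using segment_iff[OF i(1)] unfolding unshared_in_def by blast
    show "x \<in> elem i ` {1..<a i}"
      by (rule elem_fence_cases[OF i j(1)]) (use j x in \<open>auto simp: unshared_in_def shared_eq\<close>)
  qed
  show "elem i ` {1..<a i} \<subseteq> unshared_in \<alpha> i"
  proof
    fix x assume "x \<in> elem i ` {1..<a i}"
    then obtain j where j: "1 \<le> j" "j < a i" "x = elem i j" by auto
    have "x \<in> segment \<alpha> i" using segment_iff[OF i(1)] elem_in_fence[OF i j(1,2)] j less_imp_le by blast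
    moreover have "x \<noteq> p l" if "1 \<le> l" "l < s" for l
      using elem_eq_psum[OF that i, of j] j by (auto split: if_splits)
    then have "x \<notin> shared \<alpha>" unfolding shared_eq by (metis atLeastLessThan_iff imageE)
    ultimately show "x \<in> unshared_in \<alpha> i" by (simp add: unshared_in_def)
  qed
qed

text \<open>Height \<open>0\<close> is never unshared, so the unshared elements up to height
  \<open>j\<close> are exactly those at heights \<open>1\<close> to \<open>j\<close>.\<close>

lemma is_jth_smallest_iff:
  assumes i: "1 \<le> i" "i \<le> s" and j: "1 \<le> j" "j < a i"
  shows "is_jth_smallest \<alpha> (unshared_in \<alpha> i) j x \<longleftrightarrow> x = elem i j"
proof -
  have card: "card {y \<in> unshared_in \<alpha> i. (y, elem i j) \<in> fence_le \<alpha>} = j" if j: "1 \<le> j" "j < a i" for j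
  proof -
    have "{y \<in> unshared_in \<alpha> i. (y, elem i j) \<in> fence_le \<alpha>} = elem i ` {1..j}"
      (is "?L = ?R")
    proof
      show "?L \<subseteq> ?R"
      proof
        fix y assume y: "y \<in> ?L"
        then obtain c where c: "1 \<le> c" "c < a i" "y = elem i c" by (auto simp: unshared_in_eq[OF i])
        obtain c' where "c' \<le> j" "y = elem i c'" using y le_inner_iff[OF i j] by auto
        then have "c \<le> j" using elem_inj[OF i(1), of c c'] c j by simp
        then show "y \<in> ?R" using c by auto
      qed
      show "?R \<subseteq> ?L"
      proof
        fix y assume "y \<in> ?R"
        then obtain c where c: "1 \<le> c" "c \<le> j" "y = elem i c" by auto
        then show "y \<in> ?L" using elem_in_fence[OF i, of c] le_inner_iff[OF i j] j by (auto simp: unshared_in_eq[OF i])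
      qed
    qed
    moreover have "inj_on (elem i) {1..j}"
      using elem_inj[OF i(1)] j by (auto simp: inj_on_def)
    ultimately show ?thesis by (simp add: card_image)
  qed
  show ?thesis
  proof
    assume L: "is_jth_smallest \<alpha> (unshared_in \<alpha> i) j x"
    then obtain c where "1 \<le> c" "c < a i" "x = elem i c"
      by (auto simp: is_jth_smallest_def unshared_in_eq[OF i])
    then show "x = elem i j" using L card[of c] by (simp add: is_jth_smallest_def)
  next
    assume "x = elem i j"
    then show "is_jth_smallest \<alpha> (unshared_in \<alpha> i) j x"
      using card[OF j] j by (simp add: is_jth_smallest_def unshared_in_eq[OF i])
  qed
qed

text \<open>Here sliding must come from rowmotion, since the grouping into black tiles is what has
  to be justified. The tests at heights \<open>j\<close> and \<open>j + 1\<close> have opposite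
  outcomes, which pins down the element in either column.\<close>

lemma walk_slide:
  assumes X: "walk X" and i: "1 \<le> i" "i \<le> s" and j: "1 \<le> j" "j + 1 < a i"
  shows "elem i j \<in> X k \<longleftrightarrow> elem i (j + 1) \<in> X (k + 1)"
proof -
  have "row_step i (X k) (X (k + 1))"
    using rowmotion_iff_steps[OF antichains_fence[OF walk_antichain[OF X]] walk_antichain[OF X], of k "k + 1"] X i
    by (simp add: walk_def)
  then have st: "(\<exists>j'\<in>{c..a i}. elem i j' \<in> X k) \<longleftrightarrow> \<not> (\<exists>j'\<le>c. elem i j' \<in> X (k + 1))"
    if "1 \<le> c" "c < a i" for c
    using that by (auto simp: row_step_def)
  have uniq: "c = c'" if "elem i c \<in> X l" "elem i c' \<in> X l" "c \<le> a i" "c' \<le> a i" for c c' l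
    using antichains_iff[OF antichains_fence[OF walk_antichain[OF X]]] walk_antichain[OF X] that i by auto
  show ?thesis
  proof
    assume e: "elem i j \<in> X k"
    then have 1: "\<not> (\<exists>j'\<le>j. elem i j' \<in> X (k + 1))" using st[of j] j by force
    have "\<not> (\<exists>j'\<in>{j + 1..a i}. elem i j' \<in> X k)" using uniq[OF e] j by fastforce
    then obtain c where "c \<le> j + 1" "elem i c \<in> X (k + 1)" using st[of "j + 1"] j by auto
    then show "elem i (j + 1) \<in> X (k + 1)" using 1 by (metis Suc_eq_plus1 le_Suc_eq)
  next
    assume e: "elem i (j + 1) \<in> X (k + 1)"
    then have 1: "\<not> (\<exists>j'\<in>{j + 1..a i}. elem i j' \<in> X k)" using st[of "j + 1"] j by auto
    have "\<not> (\<exists>j'\<le>j. elem i j' \<in> X (k + 1))" using uniq[OF e] j by fastforce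
    then obtain c where c: "j \<le> c" "c \<le> a i" "elem i c \<in> X k" using st[of j] j by auto
    then have "c = j" using 1 by force
    then show "elem i j \<in> X k" using c by simp
  qed
qed

lemma walk_slide_run:
  assumes X: "walk X" and i: "1 \<le> i" "i \<le> s" and j: "1 \<le> j" "j < a i"
  shows "elem i j \<in> X (k + int j) \<longleftrightarrow> elem i 1 \<in> X (k + 1)"
  using j
proof (induction j rule: dec_induct)
  case (step j)
  then show ?case using walk_slide[OF X i, of j "k + int j"] by (simp add: algebra_simps)
qed simp

lemma displays_tiling_of:
  assumes A: "A \<in> antichains \<alpha>"
  shows "displays (tiling_of \<alpha> A) (\<lambda>k. rowmotion_pow \<alpha> k A)"
proof -
  define X where "X k = rowmotion_pow \<alpha> k A" for k
  have X: "walk X" using walk_rowmotion_pow[OF A] by (simp add: X_def[abs_def])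
  have XF: "X k \<subseteq> fence \<alpha>" for k using antichains_fence walk_antichain[OF X] by blast
  let ?T = "tiling_of \<alpha> A"
  have yellow: "Yellow i k \<in> ?T \<longleftrightarrow> 1 \<le> i \<and> i \<le> s \<and> X k \<inter> segment \<alpha> i = {}" for i k
    by (auto simp: tiling_of_def X_def)
  have "Red l k \<in> ?T \<longleftrightarrow> 1 \<le> l \<and> l < s \<and> segment \<alpha> l \<inter> segment \<alpha> (l + 1) \<inter> X k \<noteq> {}" for l k
    by (simp add: tiling_of_def X_def)
  then have red: "Red l k \<in> ?T \<longleftrightarrow> 1 \<le> l \<and> l < s \<and> p l \<in> X k" for l k
    by (cases "1 \<le> l \<and> l < s") (simp add: segment_Int_Suc[simplified], blast)
  have black: "Black i k \<in> ?T \<longleftrightarrow> 1 \<le> i \<and> i \<le> s \<and> 1 < a i \<and> elem i 1 \<in> X k" for i k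
  proof -
    have "Black i k \<in> ?T \<longleftrightarrow> 1 \<le> i \<and> i \<le> s \<and> 1 < a i \<and>
        (\<forall>j\<in>{1..a i - 1}. \<exists>x. is_jth_smallest \<alpha> (unshared_in \<alpha> i) j x \<and> x \<in> X (k + int j - 1))"
      by (simp add: tiling_of_def X_def)
    also have "\<dots> \<longleftrightarrow> 1 \<le> i \<and> i \<le> s \<and> 1 < a i \<and> (\<forall>j\<in>{1..a i - 1}. elem i j \<in> X (k + int j - 1))"
    proof -
      have "(\<exists>x. is_jth_smallest \<alpha> (unshared_in \<alpha> i) j x \<and> x \<in> X (k + int j - 1)) \<longleftrightarrow>
          elem i j \<in> X (k + int j - 1)"
        if "1 \<le> i" "i \<le> s" "1 < a i" "j \<in> {1..a i - 1}" for j
      proof -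
        have "1 \<le> j" "j < a i" using that by auto
        then show ?thesis using is_jth_smallest_iff[OF that(1,2)] by simp
      qed
      then show ?thesis by (auto simp del: One_nat_def)
    qed
    \<comment> \<open>Sliding propagates the first square through the whole tile, so the condition
      on all its squares collapses to one.\<close>
    also have "\<dots> \<longleftrightarrow> 1 \<le> i \<and> i \<le> s \<and> 1 < a i \<and> elem i 1 \<in> X k"
    proof -
      have "elem i j \<in> X (k + int j - 1) \<longleftrightarrow> elem i 1 \<in> X k"
        if "1 \<le> i" "i \<le> s" "j \<in> {1..a i - 1}" for j
        using walk_slide_run[OF X that(1,2), of j "k - 1"] that by (auto simp: algebra_simps)
      moreover have "1 < a i \<Longrightarrow> 1 \<in> {1..a i - 1}" by simp
      ultimately show ?thesis by blast
    qed
    finally show ?thesis .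
  qed
  have valid: "valid_tile t" if "t \<in> ?T" for t
    using that
    by (cases t) (auto simp: yellow red black valid_tile_def strip_def)
  have el: "tile_at i j k \<in> ?T \<longleftrightarrow> elem i j \<in> X k" if i: "1 \<le> i" "i \<le> s" "j \<le> a i" for i j k
  proof (cases "elem i j \<in> fence \<alpha>")
    case False
    then show ?thesis using valid_tile_at[OF i] valid XF by blast
  next
    case True
    show ?thesis
    proof (rule elem_fence_cases[OF i True])
      assume j: "1 \<le> j" "j < a i"
      then show ?thesis
        using walk_slide_run[OF X i(1,2) j, of "k - int j"] i by (simp add: tile_at_inner black)
    next
      fix l assume l: "1 \<le> l" "l < s" "i = l \<or> i = l + 1" "j = (if even l then 0 else a i)" "elem i j = p l"
      then show ?thesis using tile_at_end[OF l(3) i(1,2), of k] red by simp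
    qed
  qed
  have "displays ?T X"
    unfolding displays_def using valid XF el yellow segment_disjoint_iff[OF XF] by simp
  then show ?thesis by (simp add: X_def[abs_def])
qed

section \<open>Horizontal translations\<close>

lemma shift_tile_tile_at: "shift_tile d (tile_at i j k) = tile_at i j (k + d)"
  by (simp add: tile_at_def)

lemma shift_tile_shift_tile: "shift_tile d (shift_tile e t) = shift_tile (e + d) t"
  by (cases t) simp_all

lemma shift_tile_0: "shift_tile 0 t = t"
  by (cases t) simp_all

lemma shift_tile_image_iff: "shift_tile d t \<in> shift_tile d ` T \<longleftrightarrow> t \<in> T"
proof -
  have "inj (shift_tile d)"
    by (rule inj_on_inverseI[where g = "shift_tile (- d)"]) (simp add: shift_tile_shift_tile shift_tile_0)
  then show ?thesis by (rule inj_image_mem_iff)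
qed

lemma valid_shift_tile: "valid_tile t \<Longrightarrow> valid_tile (shift_tile d t)"
  by (cases t) (auto simp: valid_tile_def strip_def subset_iff)

lemma displays_shift:
  assumes D: "displays T X"
  shows "displays (shift_tile d ` T) (\<lambda>k. X (k - d))"
proof -
  have "Yellow i k \<in> shift_tile d ` T \<longleftrightarrow> Yellow i (k - d) \<in> T" for i k
    using shift_tile_image_iff[of d "Yellow i (k - d)"] by simp
  moreover have "tile_at i j k \<in> shift_tile d ` T \<longleftrightarrow> tile_at i j (k - d) \<in> T" for i j k
    using shift_tile_image_iff[of d "tile_at i j (k - d)"] by (simp add: shift_tile_tile_at)
  ultimately show ?thesis using D valid_shift_tile unfolding displays_def by auto
qed

lemma tiling_of_in_alpha_tilings: "A \<in> antichains \<alpha> \<Longrightarrow> tiling_of \<alpha> A \<in> alpha_tilings \<alpha>"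
  using alpha_tilings_iff_walk[OF displays_tiling_of] walk_rowmotion_pow by blast

lemma rowmotion_pow_in_antichains: "A \<in> antichains \<alpha> \<Longrightarrow> rowmotion_pow \<alpha> k A \<in> antichains \<alpha>"
  using walk_antichain[OF walk_rowmotion_pow] by blast

text \<open>After a move by \<open>d\<close>, column \<open>k\<close> shows the former column
  \<open>k - d\<close>, hence the sign. Both tile sets display the same sequence and therefore
  agree.\<close>

lemma shift_tiling_of:
  assumes A: "A \<in> antichains \<alpha>"
  shows "shift_tile d ` tiling_of \<alpha> A = tiling_of \<alpha> (rowmotion_pow \<alpha> (- d) A)"
proof (rule displays_tile_unique)
  show "displays (tiling_of \<alpha> (rowmotion_pow \<alpha> (- d) A)) (\<lambda>k. rowmotion_pow \<alpha> (k - d) A)"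
    using displays_tiling_of[OF rowmotion_pow_in_antichains[OF A, of "- d"]] rowmotion_pow_add[OF A, of _ "- d"]
    by simp
  show "displays (shift_tile d ` tiling_of \<alpha> A) (\<lambda>k. rowmotion_pow \<alpha> (k - d) A)"
    using displays_shift[OF displays_tiling_of[OF A]] .
qed

lemma equiv_translation_rel: "equiv (alpha_tilings \<alpha>) (translation_rel \<alpha>)"
proof (rule equivI)
  show "translation_rel \<alpha> \<subseteq> alpha_tilings \<alpha> \<times> alpha_tilings \<alpha>"
    by (auto simp: translation_rel_def)
  show "refl_on (alpha_tilings \<alpha>) (translation_rel \<alpha>)"
    by (auto simp: refl_on_def translation_rel_def shift_tile_0 intro!: exI[of _ 0])
  show "sym (translation_rel \<alpha>)"
  proof (rule symI)
    fix T T' assume "(T, T') \<in> translation_rel \<alpha>"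
    then obtain d where d: "T \<in> alpha_tilings \<alpha>" "T' \<in> alpha_tilings \<alpha>" "T' = shift_tile d ` T"
      by (auto simp: translation_rel_def)
    have "T = shift_tile (- d) ` T'"
      by (simp add: d(3) image_image shift_tile_shift_tile shift_tile_0)
    then show "(T', T) \<in> translation_rel \<alpha>" using d(1,2) by (auto simp: translation_rel_def)
  qed
  show "trans (translation_rel \<alpha>)"
  proof (rule transI)
    fix T T' T'' assume "(T, T') \<in> translation_rel \<alpha>" "(T', T'') \<in> translation_rel \<alpha>"
    then obtain d e where "T \<in> alpha_tilings \<alpha>" "T'' \<in> alpha_tilings \<alpha>" "T'' = shift_tile e ` shift_tile d ` T"
      by (auto simp: translation_rel_def)
    then show "(T, T'') \<in> translation_rel \<alpha>"
      by (auto simp: translation_rel_def image_image shift_tile_shift_tile)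
  qed
qed

lemma tiling_of_inj:
  assumes "A \<in> antichains \<alpha>" "B \<in> antichains \<alpha>" "tiling_of \<alpha> A = tiling_of \<alpha> B"
  shows "A = B"
  using displays_sequence_unique[OF displays_tiling_of[OF assms(1)], of "\<lambda>k. rowmotion_pow \<alpha> k B"]
    displays_tiling_of[OF assms(2)] assms(3) fun_cong[of _ _ 0] by (metis rowmotion_pow_0)

lemma tiling_of_surj:
  assumes T: "T \<in> alpha_tilings \<alpha>"
  shows "\<exists>A\<in>antichains \<alpha>. tiling_of \<alpha> A = T"
proof -
  have D: "displays T (columns T)" using displays_columns T by (simp add: alpha_tilings_def)
  then have W: "walk (columns T)" using alpha_tilings_iff_walk T by blast
  then have A: "columns T 0 \<in> antichains \<alpha>" by (rule walk_antichain)
  have "columns T = (\<lambda>k. rowmotion_pow \<alpha> k (columns T 0))"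
    using walk_eq_rowmotion_pow[OF W] by blast
  then have "displays T (\<lambda>k. rowmotion_pow \<alpha> k (columns T 0))" using D by simp
  then show ?thesis using displays_tile_unique displays_tiling_of[OF A] A by blast
qed

section \<open>Orbits and translation classes\<close>

definition orbit :: "nat set \<Rightarrow> nat set set" where
  "orbit A = {rowmotion_pow \<alpha> k A |k. True}"

lemma orbits_eq: "rowmotion_orbits \<alpha> = orbit ` antichains \<alpha>"
  by (auto simp: rowmotion_orbits_def orbit_def)

lemma orbit_eq:
  assumes A: "A \<in> antichains \<alpha>" and B: "B \<in> orbit A"
  shows "orbit B = orbit A"
proof -
  obtain d where d: "B = rowmotion_pow \<alpha> d A" using B by (auto simp: orbit_def)
  have pow: "rowmotion_pow \<alpha> k B = rowmotion_pow \<alpha> (k + d) A" for k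
    using rowmotion_pow_add[OF A] d by simp
  have "rowmotion_pow \<alpha> k A = rowmotion_pow \<alpha> (k - d) B" for k
    by (simp add: pow)
  then show ?thesis unfolding orbit_def using pow by blast
qed

lemma orbit_antichains: "A \<in> antichains \<alpha> \<Longrightarrow> orbit A \<subseteq> antichains \<alpha>"
  using rowmotion_pow_in_antichains by (auto simp: orbit_def)

text \<open>One direction makes the class independent of the chosen antichain, the other yields
  injectivity of \<open>phi\<close>. Since \<open>d\<close> ranges over all integers, its sign is
  immaterial.\<close>

lemma tiling_of_translation_iff:
  assumes A: "A \<in> antichains \<alpha>" and B: "B \<in> antichains \<alpha>"
  shows "(tiling_of \<alpha> A, tiling_of \<alpha> B) \<in> translation_rel \<alpha> \<longleftrightarrow> B \<in> orbit A"
proof -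
  have "(tiling_of \<alpha> A, tiling_of \<alpha> B) \<in> translation_rel \<alpha> \<longleftrightarrow>
      (\<exists>d. tiling_of \<alpha> B = tiling_of \<alpha> (rowmotion_pow \<alpha> (- d) A))"
    using tiling_of_in_alpha_tilings A B by (simp add: translation_rel_def shift_tiling_of)
  also have "\<dots> \<longleftrightarrow> (\<exists>d. B = rowmotion_pow \<alpha> (- d) A)"
    using tiling_of_inj[OF B rowmotion_pow_in_antichains[OF A]] by blast
  also have "\<dots> \<longleftrightarrow> B \<in> orbit A"
    unfolding orbit_def by (auto, metis minus_minus)
  finally show ?thesis .
qed

text \<open>The antichain picked by \<open>SOME\<close> lies in the same orbit as \<open>B\<close>,
  so the two tilings are translates.\<close>

lemma phi_orbit:
  assumes A: "A \<in> antichains \<alpha>" and B: "B \<in> orbit A"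
  shows "phi \<alpha> (orbit A) = translation_rel \<alpha> `` {tiling_of \<alpha> B}"
proof -
  define C where "C = (SOME C. C \<in> orbit A)"
  have C: "C \<in> orbit A" unfolding C_def using B by (rule someI)
  have "(tiling_of \<alpha> C, tiling_of \<alpha> B) \<in> translation_rel \<alpha>"
    using tiling_of_translation_iff[of C B] orbit_eq[OF A C] orbit_antichains[OF A] B C by blast
  then show ?thesis
    unfolding phi_def C_def[symmetric] by (rule equiv_class_eq[OF equiv_translation_rel])
qed

lemma orbit_self: "A \<in> orbit A"
  unfolding orbit_def using rowmotion_pow_0 by blast

lemma bij_betw_phi:
  "bij_betw (phi \<alpha>) (rowmotion_orbits \<alpha>) (alpha_tilings \<alpha> // translation_rel \<alpha>)"
  unfolding bij_betw_def
proof
  show "inj_on (phi \<alpha>) (rowmotion_orbits \<alpha>)"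
  proof (rule inj_onI)
    fix P Q assume "P \<in> rowmotion_orbits \<alpha>" "Q \<in> rowmotion_orbits \<alpha>" and eq: "phi \<alpha> P = phi \<alpha> Q"
    then obtain A B where A: "A \<in> antichains \<alpha>" "P = orbit A" and B: "B \<in> antichains \<alpha>" "Q = orbit B"
      unfolding orbits_eq by blast
    have "translation_rel \<alpha> `` {tiling_of \<alpha> A} = translation_rel \<alpha> `` {tiling_of \<alpha> B}"
      using phi_orbit[OF A(1) orbit_self] phi_orbit[OF B(1) orbit_self] eq A(2) B(2) by simp
    then have "(tiling_of \<alpha> A, tiling_of \<alpha> B) \<in> translation_rel \<alpha>"
      using eq_equiv_class[OF _ equiv_translation_rel] tiling_of_in_alpha_tilings[OF B(1)] by blast
    then have "B \<in> orbit A" using tiling_of_translation_iff A(1) B(1) by blast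
    then show "P = Q" using orbit_eq[OF A(1)] A(2) B(2) by simp
  qed
  have "phi \<alpha> ` rowmotion_orbits \<alpha> = (\<lambda>A. translation_rel \<alpha> `` {tiling_of \<alpha> A}) ` antichains \<alpha>"
    unfolding orbits_eq image_image using phi_orbit[OF _ orbit_self] by simp
  \<comment> \<open>Surjectivity: the class map is factored through the tilings themselves, all of
    which are values of \<open>tiling_of\<close>.\<close>
  also have "\<dots> = (\<lambda>T. translation_rel \<alpha> `` {T}) ` (tiling_of \<alpha> ` antichains \<alpha>)"
    by (simp add: image_image)
  also have "tiling_of \<alpha> ` antichains \<alpha> = alpha_tilings \<alpha>"
    using tiling_of_in_alpha_tilings tiling_of_surj by blast
  also have "(\<lambda>T. translation_rel \<alpha> `` {T}) ` alpha_tilings \<alpha> = alpha_tilings \<alpha> // translation_rel \<alpha>"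
    by (auto simp: quotient_def)
  finally show "phi \<alpha> ` rowmotion_orbits \<alpha> = alpha_tilings \<alpha> // translation_rel \<alpha>" .
qed

end

theorem lemma2p2:
  fixes \<alpha> :: "nat list"
  assumes "is_composition \<alpha>" and "hd \<alpha> \<ge> 2" and "last \<alpha> \<ge> 2"
  shows "(\<forall>\<O>\<in>rowmotion_orbits \<alpha>. \<forall>A\<in>\<O>.
            tiling_of \<alpha> A \<in> alpha_tilings \<alpha> \<and> phi \<alpha> \<O> = translation_rel \<alpha> `` {tiling_of \<alpha> A})
         \<and> bij_betw (phi \<alpha>) (rowmotion_orbits \<alpha>) (alpha_tilings \<alpha> // translation_rel \<alpha>)"
proof -
  interpret composition \<alpha> by unfold_locales (rule assms(1))
  have "tiling_of \<alpha> A \<in> alpha_tilings \<alpha> \<and> phi \<alpha> \<O> = translation_rel \<alpha> `` {tiling_of \<alpha> A}"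
    if "\<O> \<in> rowmotion_orbits \<alpha>" "A \<in> \<O>" for \<O> A
  proof -
    obtain B where "B \<in> antichains \<alpha>" "\<O> = orbit B"
      using \<open>\<O> \<in> rowmotion_orbits \<alpha>\<close> unfolding orbits_eq by blast
    then show ?thesis
      using phi_orbit orbit_antichains tiling_of_in_alpha_tilings \<open>A \<in> \<O>\<close> by blast
  qed
  then show ?thesis using bij_betw_phi by blast
qed

end
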